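(* Let $\Gamma=(V,E)$ be a graph with $m$ edges and let $f_\Gamma(X)\in\mathbf Q[X]$ be its class-counting polynomial. Then $$f_\Gamma(X)=\mathsf F_\Gamma(X,1)=\sum_{U\subseteq V}(X-1)^{|U|}\,X^{m+\operatorname c_\Gamma(U)-|\operatorname N_\Gamma[U]|}.$$
   Context: Graphs are finite, simple, and have at least one vertex; $\sim$ denotes adjacency; rings are associative, commutative, and unital; group commutators are $[x,y]=x^{-1}y^{-1}xy$. Graphical groups: let $\Gamma=(V,E)$ be a graph with vertices $V=\{v_1,\dotsc,v_n\}$ and let $J=\{(j,k):1\le j<k\le n,\ v_j\sim v_k\}$. For a ring $R$, $\mathbf G_\Gamma(R)$ is the group generated by symbols $x_1(r),\dotsc,x_n(r)$ and $z_{jk}(r)$ for $(j,k)\in J$, $r\in R$, subject to the defining relations (for all $i,i'\in\{1,\dotsc,n\}$, $(j,k),(j',k')\in J$, $r,r'\in R$): $x_i(r)x_i(r')=x_i(r+r')$ and $z_{jk}(r)z_{jk}(r')=z_{jk}(r+r')$; $[x_j(r),x_k(r')]=z_{jk}(rr')$; $[x_i(r),x_{i'}(r')]=1$ if $v_i\not\sim v_{i'}$; $[x_i(r),z_{jk}(r')]=[z_{j'k'}(r),z_{jk}(r')]=1$. The class-counting polynomial $f_\Gamma(X)\in\mathbf Q[X]$ is the (unique) polynomial such that, for every prime power $q$, $f_\Gamma(q)$ is the number of conjugacy classes of $\mathbf G_\Gamma(\mathbf F_q)$; its existence is a previously known theorem. For $U\subseteq V$ (not necessarily proper), $\operatorname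 c_\Gamma(U)$ is the number of connected components of the induced subgraph $\Gamma[U]$ (with $\operatorname c_\Gamma(\emptyset)=0$), and $\operatorname N_\Gamma[U]$ is the set of all vertices that lie in $U$ or are adjacent to an element of $U$. The class-size polynomial is $$\mathsf F_\Gamma(X,Y)=\sum_{U\subseteq V}(X-1)^{|U|}\,X^{m+\operatorname c_\Gamma(U)-|\operatorname N_\Gamma[U]|}\,Y^{|\operatorname N_\Gamma[U]|-\operatorname c_\Gamma(U)}\in\mathbf Z[X,Y].$$ *)

theory Defs
  imports
    "HOL-Algebra.Group_Action"
    "HOL-Algebra.Ring"
    "HOL-Computational_Algebra.Polynomial"
    "HOL-Number_Theory.Prime_Powers"
begin

section \<open>Group presentations\<close>

text \<open>A letter \<open>(g, False)\<close> stands for the generator \<open>g\<close>, and \<open>(g, True)\<close> for its inverse.\<close>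

type_synonym 'g word = "('g \<times> bool) list"

definition words :: "'g set \<Rightarrow> 'g word set"
  where "words S = lists (S \<times> UNIV)"

definition letter :: "'g \<Rightarrow> 'g word"
  where "letter g = [(g, False)]"

definition word_inv :: "'g word \<Rightarrow> 'g word"
  where "word_inv w = rev (map (\<lambda>(g, b). (g, \<not> b)) w)"

definition word_comm :: "'g word \<Rightarrow> 'g word \<Rightarrow> 'g word"
  where "word_comm x y = word_inv x @ word_inv y @ x @ y"

text \<open>The congruence on words over \<open>S\<close> generated by free cancellation and by the
  relations \<open>u = v\<close> for \<open>(u, v) \<in> P\<close>.\<close>

inductive_set word_cong :: "'g set \<Rightarrow> ('g word \<times> 'g word) set \<Rightarrow> ('g word \<times> 'g word) set"
  for S :: "'g set" and P :: "('g word \<times> 'g word) set"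
  where
    refl: "w \<in> words S \<Longrightarrow> (w, w) \<in> word_cong S P"
  | sym: "(u, v) \<in> word_cong S P \<Longrightarrow> (v, u) \<in> word_cong S P"
  | trans: "(u, v) \<in> word_cong S P \<Longrightarrow> (v, w) \<in> word_cong S P \<Longrightarrow> (u, w) \<in> word_cong S P"
  | append: "(u, u') \<in> word_cong S P \<Longrightarrow> (v, v') \<in> word_cong S P
      \<Longrightarrow> (u @ v, u' @ v') \<in> word_cong S P"
  | cancel: "g \<in> S \<Longrightarrow> ([(g, b), (g, \<not> b)], []) \<in> word_cong S P"
  | relation: "(u, v) \<in> P \<Longrightarrow> u \<in> words S \<Longrightarrow> v \<in> words S \<Longrightarrow> (u, v) \<in> word_cong S P"

definition presented_group :: "'g set \<Rightarrow> ('g word \<times> 'g word) set \<Rightarrow> 'g word set monoid"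
  where "presented_group S P =
    \<lparr>carrier = words S // word_cong S P,
     monoid.mult = (\<lambda>A B. \<Union>a\<in>A. \<Union>b\<in>B. word_cong S P `` {a @ b}),
     one = word_cong S P `` {[]}\<rparr>"

lemma words_simps [simp]:
  "[] \<in> words S"
  "u @ v \<in> words S \<longleftrightarrow> u \<in> words S \<and> v \<in> words S"
  "word_inv u \<in> words S \<longleftrightarrow> u \<in> words S"
  by (auto simp: words_def word_inv_def in_lists_conv_set split: prod.splits)

lemma word_cong_words: "(u, v) \<in> word_cong S P \<Longrightarrow> u \<in> words S \<and> v \<in> words S"
  by (induction rule: word_cong.induct) (auto simp: words_def)

lemma equiv_word_cong: "equiv (words S) (word_cong S P)"
  by (intro equivI refl_onI symI transI)
    (auto dest: word_cong_words intro: word_cong.intros)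

lemma presented_group_mult:
  assumes "u \<in> words S" "v \<in> words S"
  shows "word_cong S P `` {u} \<otimes>\<^bsub>presented_group S P\<^esub> word_cong S P `` {v}
    = word_cong S P `` {u @ v}"
proof -
  have "(\<Union>b\<in>word_cong S P `` {v}. word_cong S P `` {a @ b}) = word_cong S P `` {u @ v}"
    if a: "(u, a) \<in> word_cong S P" for a
  proof -
    have "word_cong S P `` {a @ b} = word_cong S P `` {u @ v}" if "(v, b) \<in> word_cong S P" for b
      using equiv_class_eq[OF equiv_word_cong word_cong.append[OF a that]] by simp
    moreover have "v \<in> word_cong S P `` {v}"
      using assms by (auto intro: word_cong.refl)
    ultimately show ?thesis by auto
  qed
  moreover have "u \<in> word_cong S P `` {u}"
    using assms by (auto intro: word_cong.refl)
  ultimately show ?thesis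
    by (auto simp: presented_group_def)
qed

lemma word_inv_cancel: "w \<in> words S \<Longrightarrow> (word_inv w @ w, []) \<in> word_cong S P"
proof (induction w)
  case Nil
  then show ?case by (simp add: word_inv_def word_cong.refl)
next
  case (Cons l w)
  obtain g b where l: "l = (g, b)" by (cases l)
  have g: "g \<in> S" and w: "w \<in> words S"
    using Cons.prems by (auto simp: l words_def)
  have "(word_inv w @ [(g, \<not> b), (g, b)] @ w, word_inv w @ [] @ w) \<in> word_cong S P"
    using word_cong.cancel[OF g, of "\<not> b"] w by (intro word_cong.append) (auto intro: word_cong.refl)
  then show ?case
    using Cons.IH[OF w] by (auto simp: l word_inv_def intro: word_cong.trans)
qed

lemma group_presented_group: "group (presented_group S P)"
proof (rule groupI)
  let ?G = "presented_group S P"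
  have carr: "\<exists>u\<in>words S. A = word_cong S P `` {u}" if "A \<in> carrier ?G" for A
    using that by (auto simp: presented_group_def quotient_def)
  have carrI: "word_cong S P `` {u} \<in> carrier ?G" if "u \<in> words S" for u
    using that by (auto simp: presented_group_def quotient_def)
  have one: "\<one>\<^bsub>?G\<^esub> = word_cong S P `` {[]}"
    by (simp add: presented_group_def)
  show "A \<otimes>\<^bsub>?G\<^esub> B \<in> carrier ?G" if "A \<in> carrier ?G" "B \<in> carrier ?G" for A B
    using carr[OF that(1)] carr[OF that(2)] by (auto simp: presented_group_mult carrI)
  show "\<one>\<^bsub>?G\<^esub> \<in> carrier ?G"
    by (simp add: one carrI)
  show "A \<otimes>\<^bsub>?G\<^esub> B \<otimes>\<^bsub>?G\<^esub> C = A \<otimes>\<^bsub>?G\<^esub> (B \<otimes>\<^bsub>?G\<^esub> C)"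
    if "A \<in> carrier ?G" "B \<in> carrier ?G" "C \<in> carrier ?G" for A B C
    using carr[OF that(1)] carr[OF that(2)] carr[OF that(3)] by (auto simp: presented_group_mult)
  show "\<one>\<^bsub>?G\<^esub> \<otimes>\<^bsub>?G\<^esub> A = A" if "A \<in> carrier ?G" for A
    using carr[OF that] by (auto simp: one presented_group_mult)
  show "\<exists>B\<in>carrier ?G. B \<otimes>\<^bsub>?G\<^esub> A = \<one>\<^bsub>?G\<^esub>" if A: "A \<in> carrier ?G" for A
  proof -
    obtain u where u: "u \<in> words S" "A = word_cong S P `` {u}"
      using carr[OF A] by blast
    show ?thesis
      using u equiv_class_eq[OF equiv_word_cong word_inv_cancel[OF u(1)]]
      by (intro bexI[of _ "word_cong S P `` {word_inv u}"])
        (simp_all add: one presented_group_mult carrI)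
  qed
qed


section \<open>Graphs\<close>

definition simple_graph :: "'v set \<Rightarrow> 'v set set \<Rightarrow> bool"
  where "simple_graph V E \<longleftrightarrow> finite V \<and> V \<noteq> {} \<and> E \<subseteq> {e. e \<subseteq> V \<and> card e = 2}"

definition adjacent :: "'v set set \<Rightarrow> 'v \<Rightarrow> 'v \<Rightarrow> bool"
  where "adjacent E u w \<longleftrightarrow> {u, w} \<in> E"

definition induced_edges :: "'v set set \<Rightarrow> 'v set \<Rightarrow> 'v set set"
  where "induced_edges E U = {e \<in> E. e \<subseteq> U}"

definition connected_components :: "'v set \<Rightarrow> 'v set set \<Rightarrow> 'v set set"
  where "connected_components V E = V // {(u, w). adjacent E u w}\<^sup>*"

definition num_components :: "'v set set \<Rightarrow> 'v set \<Rightarrow> nat"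
  where "num_components E U = card (connected_components U (induced_edges E U))"

definition closed_nbhd :: "'v set \<Rightarrow> 'v set set \<Rightarrow> 'v set \<Rightarrow> 'v set"
  where "closed_nbhd V E U = {w \<in> V. w \<in> U \<or> (\<exists>u\<in>U. adjacent E u w)}"


section \<open>Graphical groups\<close>

text \<open>Throughout, \<open>v 1, \<dots>, v n\<close> enumerates the vertices, where \<open>n = card V\<close>.\<close>

datatype 'r graphical_gen = XGen nat 'r | ZGen nat nat 'r

definition edge_indices :: "'v set \<Rightarrow> 'v set set \<Rightarrow> (nat \<Rightarrow> 'v) \<Rightarrow> (nat \<times> nat) set"
  where "edge_indices V E v = {(j, k). 1 \<le> j \<and> j < k \<and> k \<le> card V \<and> adjacent E (v j) (v k)}"

definition graphical_gens ::
    "'v set \<Rightarrow> 'v set set \<Rightarrow> (nat \<Rightarrow> 'v) \<Rightarrow> ('r, 'm) ring_scheme \<Rightarrow> 'r graphical_gen set"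
  where "graphical_gens V E v R =
    {XGen i r | i r. i \<in> {1..card V} \<and> r \<in> carrier R} \<union>
    {ZGen j k r | j k r. (j, k) \<in> edge_indices V E v \<and> r \<in> carrier R}"

abbreviation x_letter :: "nat \<Rightarrow> 'r \<Rightarrow> 'r graphical_gen word"
  where "x_letter i r \<equiv> letter (XGen i r)"

abbreviation z_letter :: "nat \<Rightarrow> nat \<Rightarrow> 'r \<Rightarrow> 'r graphical_gen word"
  where "z_letter j k r \<equiv> letter (ZGen j k r)"

inductive_set graphical_relations ::
    "'v set \<Rightarrow> 'v set set \<Rightarrow> (nat \<Rightarrow> 'v) \<Rightarrow> ('r, 'm) ring_scheme
      \<Rightarrow> ('r graphical_gen word \<times> 'r graphical_gen word) set"
  for V :: "'v set" and E :: "'v set set" and v :: "nat \<Rightarrow> 'v" and R :: "('r, 'm) ring_scheme"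
  where
    x_add: "\<lbrakk>i \<in> {1..card V}; r \<in> carrier R; r' \<in> carrier R\<rbrakk>
      \<Longrightarrow> (x_letter i r @ x_letter i r', x_letter i (r \<oplus>\<^bsub>R\<^esub> r')) \<in> graphical_relations V E v R"
  | z_add: "\<lbrakk>(j, k) \<in> edge_indices V E v; r \<in> carrier R; r' \<in> carrier R\<rbrakk>
      \<Longrightarrow> (z_letter j k r @ z_letter j k r', z_letter j k (r \<oplus>\<^bsub>R\<^esub> r'))
          \<in> graphical_relations V E v R"
  | x_comm_adjacent: "\<lbrakk>(j, k) \<in> edge_indices V E v; r \<in> carrier R; r' \<in> carrier R\<rbrakk>
      \<Longrightarrow> (word_comm (x_letter j r) (x_letter k r'), z_letter j k (r \<otimes>\<^bsub>R\<^esub> r'))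
          \<in> graphical_relations V E v R"
  | x_comm_nonadjacent: "\<lbrakk>i \<in> {1..card V}; i' \<in> {1..card V}; \<not> adjacent E (v i) (v i');
        r \<in> carrier R; r' \<in> carrier R\<rbrakk>
      \<Longrightarrow> (word_comm (x_letter i r) (x_letter i' r'), []) \<in> graphical_relations V E v R"
  | xz_comm: "\<lbrakk>i \<in> {1..card V}; (j, k) \<in> edge_indices V E v; r \<in> carrier R; r' \<in> carrier R\<rbrakk>
      \<Longrightarrow> (word_comm (x_letter i r) (z_letter j k r'), []) \<in> graphical_relations V E v R"
  | zz_comm: "\<lbrakk>(j', k') \<in> edge_indices V E v; (j, k) \<in> edge_indices V E v;
        r \<in> carrier R; r' \<in> carrier R\<rbrakk>
      \<Longrightarrow> (word_comm (z_letter j' k' r) (z_letter j k r'), []) \<in> graphical_relations V E v R"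

definition graphical_group ::
    "'v set \<Rightarrow> 'v set set \<Rightarrow> (nat \<Rightarrow> 'v) \<Rightarrow> ('r, 'm) ring_scheme \<Rightarrow> 'r graphical_gen word set monoid"
  where "graphical_group V E v R =
    presented_group (graphical_gens V E v R) (graphical_relations V E v R)"


section \<open>Class-counting and class-size polynomials\<close>

definition conjugacy_classes :: "('a, 'm) monoid_scheme \<Rightarrow> 'a set set"
  where "conjugacy_classes G =
    orbits G (carrier G) (\<lambda>g. \<lambda>h \<in> carrier G. g \<otimes>\<^bsub>G\<^esub> h \<otimes>\<^bsub>G\<^esub> inv\<^bsub>G\<^esub> g)"

text \<open>Fields with \<open>q\<close> elements are taken with carrier a set of integers. Every finite field is
  isomorphic to one of this form, and isomorphic rings yield isomorphic graphical groups.\<close>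

definition is_class_counting_poly ::
    "'v set \<Rightarrow> 'v set set \<Rightarrow> (nat \<Rightarrow> 'v) \<Rightarrow> rat poly \<Rightarrow> bool"
  where "is_class_counting_poly V E v f \<longleftrightarrow>
    (\<forall>q. primepow q \<longrightarrow>
      (\<forall>K :: int ring. field K \<and> finite (carrier K) \<and> card (carrier K) = q \<longrightarrow>
        poly f (of_nat q) = of_nat (card (conjugacy_classes (graphical_group V E v K)))))"

definition class_counting_poly :: "'v set \<Rightarrow> 'v set set \<Rightarrow> (nat \<Rightarrow> 'v) \<Rightarrow> rat poly"
  where "class_counting_poly V E v = (THE f. is_class_counting_poly V E v f)"

text \<open>\<open>\<int>[X, Y]\<close> is represented as \<open>\<int>[X][Y]\<close>, so \<open>X\<close> is a constant of the outer polynomial ring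
  and \<open>poly F 1\<close> is the specialisation \<open>F(X, 1)\<close>. Both truncated subtractions are exact:
  each component of \<open>\<Gamma>[U]\<close> contains a vertex of \<open>U\<close>, whence \<open>c(U) \<le> |N[U]|\<close>; and the graph with
  vertices \<open>N[U]\<close> and those edges of \<open>\<Gamma>\<close> that meet \<open>U\<close> and lie in \<open>N[U]\<close> has \<open>c'\<close> components
  with \<open>|N[U]| - m \<le> c' \<le> c(U)\<close>.\<close>

definition class_size_poly :: "'v set \<Rightarrow> 'v set set \<Rightarrow> int poly poly"
  where "class_size_poly V E =
    (let X = [:[:0, 1:]:]; Y = [:0, 1:] in
      \<Sum>U\<in>Pow V. (X - 1) ^ card U
        * X ^ (card E + num_components E U - card (closed_nbhd V E U))
        * Y ^ (card (closed_nbhd V E U) - num_components E U))"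

end

theory Submission
  imports Defs "HOL-Number_Theory.Residues"
begin

text \<open>Writing \<open>V = {v\<^sub>1, \<dots>, v\<^sub>n}\<close>, the graphical group over \<open>R\<close> is the set \<open>R\<^sup>V \<times> R\<^sup>E\<close> with the
  product \<open>(x, s) (y, t) = (x + y, s + t + \<beta>(x, y))\<close>, \<open>\<beta>(x, y)\<^sub>j\<^sub>k = - x\<^sub>k y\<^sub>j\<close>. Hence \<open>(x, s)\<close> and
  \<open>(y, t)\<close> commute iff \<open>x\<^sub>a y\<^sub>b = x\<^sub>b y\<^sub>a\<close> along every edge \<open>ab\<close>. Over a field with \<open>q\<close> elements and
  for \<open>x\<close> of support \<open>U\<close>, the solutions \<open>y\<close> are proportional to \<open>x\<close> on each component of \<open>\<Gamma>[U]\<close>,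
  vanish on \<open>N[U] - U\<close> and are arbitrary outside \<open>N[U]\<close>, so there are \<open>q\<close> to the power
  \<open>c(U) + n - |N[U]|\<close> of them. Burnside's lemma turns this count of commuting pairs into the
  number of conjugacy classes, and the values at primes determine the polynomial.\<close>

section \<open>Homomorphisms from presented groups\<close>

definition word_eval :: "('h, 'm) monoid_scheme \<Rightarrow> ('g \<Rightarrow> 'h) \<Rightarrow> 'g word \<Rightarrow> 'h"
  where "word_eval H f w =
    foldr (\<lambda>(g, b) a. (if b then inv\<^bsub>H\<^esub> f g else f g) \<otimes>\<^bsub>H\<^esub> a) w \<one>\<^bsub>H\<^esub>"

lemma word_eval_simps [simp]:
  "word_eval H f [] = \<one>\<^bsub>H\<^esub>"
  "word_eval H f ((g, b) # w) = (if b then inv\<^bsub>H\<^esub> f g else f g) \<otimes>\<^bsub>H\<^esub> word_eval H f w"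
  by (simp_all add: word_eval_def)

lemma words_Cons [simp]: "(g, b) # w \<in> words S \<longleftrightarrow> g \<in> S \<and> w \<in> words S"
  by (auto simp: words_def)

lemma (in group) word_eval_closed [simp, intro]:
  assumes "f \<in> S \<rightarrow> carrier G" "w \<in> words S"
  shows "word_eval G f w \<in> carrier G"
  using assms(2)
proof (induction w)
  case (Cons l w)
  then show ?case using assms(1) by (cases l) auto
qed simp

lemma (in group) word_eval_append:
  assumes "f \<in> S \<rightarrow> carrier G" "u \<in> words S" "w \<in> words S"
  shows "word_eval G f (u @ w) = word_eval G f u \<otimes> word_eval G f w"
  using assms(2)
proof (induction u)
  case (Cons l u)
  obtain g b where l: "l = (g, b)" by (cases l)
  have "f g \<in> carrier G" "u \<in> words S"
    using Cons.prems assms(1) by (auto simp: l)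
  with Cons.IH show ?case
    using word_eval_closed[OF assms(1)] assms(3) by (auto simp: l m_assoc)
qed (use assms in auto)

text \<open>Having the same value in the group is a congruence on words over \<open>S\<close> that
  respects free cancellation, so it contains the generated congruence once it contains
  \<open>P\<close>.\<close>

lemma (in group) word_eval_cong:
  assumes f: "f \<in> S \<rightarrow> carrier G"
    and rel: "\<And>u w. (u, w) \<in> P \<Longrightarrow> u \<in> words S \<Longrightarrow> w \<in> words S \<Longrightarrow> word_eval G f u = word_eval G f w"
    and "(u, w) \<in> word_cong S P"
  shows "word_eval G f u = word_eval G f w"
  using assms(3)
proof induction
  case (append u u' w w')
  then have "u \<in> words S" "u' \<in> words S" "w \<in> words S" "w' \<in> words S"
    using word_cong_words by blast+
  then show ?case
    using append.IH by (simp add: word_eval_append[OF f])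
next
  case (cancel g b)
  then have "f g \<in> carrier G" using f by auto
  then show ?case by auto
qed (use rel in auto)

text \<open>The universal property of a presentation: by \<open>word_eval_cong\<close> the value of
  a word depends only on its class, so an assignment of generators that satisfies the relations
  extends to a homomorphism.\<close>

lemma (in group) presented_group_hom:
  assumes f: "f \<in> S \<rightarrow> carrier G"
    and rel: "\<And>u w. (u, w) \<in> P \<Longrightarrow> u \<in> words S \<Longrightarrow> w \<in> words S \<Longrightarrow> word_eval G f u = word_eval G f w"
  obtains \<phi> where "\<phi> \<in> hom (presented_group S P) G"
    and "\<And>u. u \<in> words S \<Longrightarrow> \<phi> (word_cong S P `` {u}) = word_eval G f u"
proof
  define \<phi> where "\<phi> A = word_eval G f (SOME u. u \<in> A)" for A
  show *: "\<phi> (word_cong S P `` {u}) = word_eval G f u" if "u \<in> words S" for u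
  proof -
    have "(u, SOME w. w \<in> word_cong S P `` {u}) \<in> word_cong S P"
      using word_cong.refl[OF that, of P] by (metis Image_singleton_iff someI)
    then show ?thesis
      unfolding \<phi>_def using word_eval_cong[OF f rel] by metis
  qed
  show "\<phi> \<in> hom (presented_group S P) G"
  proof (rule homI)
    fix A B
    assume "A \<in> carrier (presented_group S P)" "B \<in> carrier (presented_group S P)"
    then obtain a b where "a \<in> words S" "A = word_cong S P `` {a}"
        "b \<in> words S" "B = word_cong S P `` {b}"
      by (auto simp: presented_group_def quotient_def)
    then show "\<phi> A \<in> carrier G" "\<phi> (A \<otimes>\<^bsub>presented_group S P\<^esub> B) = \<phi> A \<otimes> \<phi> B"
      by (auto simp: presented_group_mult * word_eval_append[OF f] intro!: word_eval_closed[OF f])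
  qed
qed

text \<open>Every class contains a word, and words grow by prefixing letters. A set that contains
  the identity and is stable under left multiplication by all letters, inverse ones included, is
  therefore the whole group.\<close>

lemma presented_group_induct [consumes 1, case_names one mult]:
  assumes "A \<in> carrier (presented_group S P)"
    and "Q \<one>\<^bsub>presented_group S P\<^esub>"
    and "\<And>g b A. g \<in> S \<Longrightarrow> A \<in> carrier (presented_group S P) \<Longrightarrow> Q A \<Longrightarrow>
      Q (word_cong S P `` {[(g, b)]} \<otimes>\<^bsub>presented_group S P\<^esub> A)"
  shows "Q A"
proof -
  have "Q (word_cong S P `` {w})" if "w \<in> words S" for w
    using that
  proof (induction w)
    case Nil
    then show ?case using assms(2) by (simp add: presented_group_def)
  next
    case (Cons l w)
    obtain g b where l: "l = (g, b)" by (cases l)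
    have "g \<in> S" "w \<in> words S" using Cons.prems by (auto simp: l)
    with assms(3)[of g "word_cong S P `` {w}" b] Cons.IH presented_group_mult[of "[l]" S w P]
    show ?case by (auto simp: l presented_group_def quotient_def)
  qed
  then show ?thesis
    using assms(1) by (auto simp: presented_group_def quotient_def)
qed

text \<open>With the convention [a, b] = a^-1 b^-1 a b, the commutator is the right factor that
  corrects \<open>b a\<close> to \<open>a b\<close>. In this form the relations can be checked and
  applied without inverses.\<close>

lemma (in group) comm_eq_iff:
  assumes "a \<in> carrier G" "b \<in> carrier G" "c \<in> carrier G"
  shows "inv a \<otimes> (inv b \<otimes> (a \<otimes> b)) = c \<longleftrightarrow> a \<otimes> b = b \<otimes> a \<otimes> c"
  using assms by (simp add: inv_solve_left' m_assoc)

lemma word_inv_single [simp]: "word_inv [(g, b)] = [(g, \<not> b)]"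
  by (simp add: word_inv_def)

lemma (in group) word_eval_comm_eq:
  assumes "f \<in> S \<rightarrow> carrier G" "g \<in> S" "h \<in> S" "c \<in> carrier G"
  shows "word_eval G f (word_comm (letter g) (letter h)) = c \<longleftrightarrow> f g \<otimes> f h = f h \<otimes> f g \<otimes> c"
proof -
  have "f g \<in> carrier G" "f h \<in> carrier G" using assms by auto
  then show ?thesis
    using comm_eq_iff[of "f g" "f h" c] assms by (simp add: word_comm_def letter_def)
qed

text \<open>The word h g [g, h] = h g g^-1 h^-1 g h cancels freely to g h, so prefixing the relation
  [g, h] = w by h g turns it into a commutation rule.\<close>

lemma presented_group_comm:
  assumes "(word_comm (letter g) (letter h), w) \<in> P" "g \<in> S" "h \<in> S" "w \<in> words S"
  shows "word_cong S P `` {letter g} \<otimes>\<^bsub>presented_group S P\<^esub> word_cong S P `` {letter h}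
    = word_cong S P `` {letter h} \<otimes>\<^bsub>presented_group S P\<^esub> word_cong S P `` {letter g}
      \<otimes>\<^bsub>presented_group S P\<^esub> word_cong S P `` {w}"
proof -
  let ?R = "word_cong S P"
  have 1: "(word_comm (letter g) (letter h), w) \<in> ?R"
    using assms by (intro word_cong.relation) (auto simp: word_comm_def letter_def)
  have "(letter h @ letter g @ word_comm (letter g) (letter h), letter h @ letter g @ w) \<in> ?R"
    using assms by (intro word_cong.append 1 word_cong.refl) (auto simp: letter_def)
  \<comment> \<open>The inner pair g g^-1 has to cancel first; only then do h and h^-1 become
    neighbours.\<close>
  moreover have "(letter h @ ([(g, False), (g, \<not> False)] @ [(h, True)]) @ letter g @ letter h,
      letter h @ ([] @ [(h, True)]) @ letter g @ letter h) \<in> ?R"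
    using assms by (intro word_cong.append word_cong.refl word_cong.cancel) (auto simp: letter_def)
  moreover have "([(h, False), (h, \<not> False)] @ letter g @ letter h, [] @ letter g @ letter h) \<in> ?R"
    using assms by (intro word_cong.append word_cong.refl word_cong.cancel) (auto simp: letter_def)
  ultimately have "(letter g @ letter h, letter h @ letter g @ w) \<in> ?R"
    by (simp add: word_comm_def letter_def) (meson word_cong.trans word_cong.sym)
  then have "?R `` {letter g @ letter h} = ?R `` {letter h @ letter g @ w}"
    by (rule equiv_class_eq[OF equiv_word_cong])
  then show ?thesis
    using assms by (simp add: presented_group_mult letter_def)
qed

section \<open>The coordinate model of a graphical group\<close>

locale graphical = R: cring R for R (structure) +
  fixes V :: "'v set" and E :: "'v set set" and v :: "nat \<Rightarrow> 'v"
  assumes graph: "simple_graph V E" and enum: "bij_betw v {1..card V} V"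
begin

abbreviation "J \<equiv> edge_indices V E v"

abbreviation "GG \<equiv> graphical_group V E v R"

text \<open>For j < k the term -x_k y_j is the cost of moving entry j of the second factor to the
  left past entry k of the first. This is the multiplication of products of generators in increasing
  order of the index, followed by a central part. Extensional functions make equality of elements
  the same as equality of coordinates.\<close>

definition model :: "(('v \<Rightarrow> 'a) \<times> (nat \<times> nat \<Rightarrow> 'a)) monoid"
  where "model = \<lparr>carrier = (V \<rightarrow>\<^sub>E carrier R) \<times> (J \<rightarrow>\<^sub>E carrier R),
    monoid.mult = (\<lambda>(x, s) (y, t). (\<lambda>a\<in>V. x a \<oplus> y a,
      \<lambda>p\<in>J. s p \<oplus> t p \<ominus> x (v (snd p)) \<otimes> y (v (fst p)))),
    one = (\<lambda>a\<in>V. \<zero>, \<lambda>p\<in>J. \<zero>)\<rparr>"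

lemma finite_V: "finite V"
  using graph by (simp add: simple_graph_def)

lemma v_mem [simp]: "i \<in> {1..card V} \<Longrightarrow> v i \<in> V"
  using enum by (auto simp: bij_betw_def)

lemma v_eq_iff [simp]: "i \<in> {1..card V} \<Longrightarrow> j \<in> {1..card V} \<Longrightarrow> v i = v j \<longleftrightarrow> i = j"
  using enum by (auto simp: bij_betw_def inj_on_eq_iff)

lemma edge_indicesD: "p \<in> J \<Longrightarrow> fst p \<in> {1..card V} \<and> snd p \<in> {1..card V} \<and> fst p < snd p"
  by (auto simp: edge_indices_def)

lemma edge_indices_mem [simp]: "p \<in> J \<Longrightarrow> v (fst p) \<in> V" "p \<in> J \<Longrightarrow> v (snd p) \<in> V"
  using edge_indicesD by simp_all

lemma edge_indices_pair_mem [simp]: "(j, k) \<in> J \<Longrightarrow> v j \<in> V" "(j, k) \<in> J \<Longrightarrow> v k \<in> V"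
  using edge_indices_mem[of "(j, k)"] by simp_all

lemma finite_J: "finite J"
  by (rule finite_subset[of _ "{1..card V} \<times> {1..card V}"]) (auto simp: edge_indices_def)

lemma model_mult_fst: "fst (a \<otimes>\<^bsub>model\<^esub> b) = (\<lambda>c\<in>V. fst a c \<oplus> fst b c)"
  by (simp add: model_def split: prod.splits)

lemma model_mult_snd: "snd (a \<otimes>\<^bsub>model\<^esub> b) =
    (\<lambda>p\<in>J. snd a p \<oplus> snd b p \<ominus> fst a (v (snd p)) \<otimes> fst b (v (fst p)))"
  by (simp add: model_def split: prod.splits)

lemma model_one: "\<one>\<^bsub>model\<^esub> = (\<lambda>a\<in>V. \<zero>, \<lambda>p\<in>J. \<zero>)"
  by (simp add: model_def)

lemma model_one_mem [simp]: "(\<lambda>a\<in>V. \<zero>, \<lambda>p\<in>J. \<zero>) \<in> carrier model"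
  by (simp add: model_def)

lemma model_carrier: "carrier model = (V \<rightarrow>\<^sub>E carrier R) \<times> (J \<rightarrow>\<^sub>E carrier R)"
  by (simp add: model_def)

lemma model_memD [simp]:
  "a \<in> carrier model \<Longrightarrow> c \<in> V \<Longrightarrow> fst a c \<in> carrier R"
  "a \<in> carrier model \<Longrightarrow> p \<in> J \<Longrightarrow> snd a p \<in> carrier R"
  by (auto simp: model_carrier)

lemma model_closed [simp]:
  assumes "a \<in> carrier model" "b \<in> carrier model"
  shows "a \<otimes>\<^bsub>model\<^esub> b \<in> carrier model"
  unfolding model_carrier mem_Times_iff model_mult_fst model_mult_snd using assms by auto

lemma model_eqI:
  assumes "a \<in> carrier model" "b \<in> carrier model"
    and "\<And>c. c \<in> V \<Longrightarrow> fst a c = fst b c" "\<And>p. p \<in> J \<Longrightarrow> snd a p = snd b p"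
  shows "a = b"
proof (rule prod_eqI)
  show "fst a = fst b"
    using assms by (intro PiE_ext[of _ V "\<lambda>_. carrier R"]) (auto simp: model_carrier)
  show "snd a = snd b"
    using assms by (intro PiE_ext[of _ J "\<lambda>_. carrier R"]) (auto simp: model_carrier)
qed

text \<open>Associativity amounts to \<beta> being additive in each argument: both bracketings
  collect the same three pairwise terms.\<close>

lemma group_model: "group model"
proof (rule groupI)
  show one: "\<one>\<^bsub>model\<^esub> \<in> carrier model"
    by (simp add: model_def)
  show "a \<otimes>\<^bsub>model\<^esub> b \<otimes>\<^bsub>model\<^esub> c = a \<otimes>\<^bsub>model\<^esub> (b \<otimes>\<^bsub>model\<^esub> c)"
    if "a \<in> carrier model" "b \<in> carrier model" "c \<in> carrier model" for a b c
  proof (rule model_eqI)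
    fix p assume p: "p \<in> J"
    let ?k = "v (snd p)" and ?j = "v (fst p)"
    have "snd a p \<oplus> snd b p \<ominus> fst a ?k \<otimes> fst b ?j \<oplus> snd c p \<ominus> (fst a ?k \<oplus> fst b ?k) \<otimes> fst c ?j
      = snd a p \<oplus> (snd b p \<oplus> snd c p \<ominus> fst b ?k \<otimes> fst c ?j) \<ominus> fst a ?k \<otimes> (fst b ?j \<oplus> fst c ?j)"
      if "snd a p \<in> carrier R" "snd b p \<in> carrier R" "snd c p \<in> carrier R"
        "fst a ?k \<in> carrier R" "fst b ?k \<in> carrier R" "fst b ?j \<in> carrier R" "fst c ?j \<in> carrier R"
      using that by algebra
    then show "snd (a \<otimes>\<^bsub>model\<^esub> b \<otimes>\<^bsub>model\<^esub> c) p = snd (a \<otimes>\<^bsub>model\<^esub> (b \<otimes>\<^bsub>model\<^esub> c)) p"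
      using that p by (simp add: model_mult_fst model_mult_snd)
  qed (use that in \<open>auto simp: model_mult_fst R.a_assoc\<close>)
  show "\<one>\<^bsub>model\<^esub> \<otimes>\<^bsub>model\<^esub> a = a" if "a \<in> carrier model" for a
    using that one
    by (intro model_eqI) (auto simp: model_mult_fst model_mult_snd model_one R.minus_eq)
  show "\<exists>b\<in>carrier model. b \<otimes>\<^bsub>model\<^esub> a = \<one>\<^bsub>model\<^esub>" if a: "a \<in> carrier model" for a
  proof
    \<comment> \<open>Since \<beta>(-x, x) has the entries x_k x_j, the second coordinate of the
      inverse is -s - x_k x_j and not merely -s.\<close>
    let ?b = "(\<lambda>c\<in>V. \<ominus> fst a c, \<lambda>p\<in>J. \<ominus> snd a p \<ominus> fst a (v (snd p)) \<otimes> fst a (v (fst p)))"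
    show b: "?b \<in> carrier model"
      using a by (auto simp: model_carrier)
    show "?b \<otimes>\<^bsub>model\<^esub> a = \<one>\<^bsub>model\<^esub>"
    proof (rule model_eqI)
      fix p assume p: "p \<in> J"
      have "\<ominus> s \<ominus> k \<otimes> j \<oplus> s \<ominus> (\<ominus> k) \<otimes> j = \<zero>"
        if "s \<in> carrier R" "k \<in> carrier R" "j \<in> carrier R" for s k j
        using that by algebra
      then show "snd (?b \<otimes>\<^bsub>model\<^esub> a) p = snd \<one>\<^bsub>model\<^esub> p"
        using a p by (simp add: model_mult_snd model_one)
    qed (use a b one in \<open>auto simp: model_mult_fst model_one R.l_neg\<close>)
  qed
qed simp

section \<open>The defining relations hold in the model\<close>

definition gen_image :: "'a graphical_gen \<Rightarrow> ('v \<Rightarrow> 'a) \<times> (nat \<times> nat \<Rightarrow> 'a)"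
  where "gen_image g = (case g of
    XGen i r \<Rightarrow> (\<lambda>a\<in>V. if a = v i then r else \<zero>, \<lambda>p\<in>J. \<zero>)
  | ZGen j k r \<Rightarrow> (\<lambda>a\<in>V. \<zero>, \<lambda>p\<in>J. if p = (j, k) then r else \<zero>))"

abbreviation "gens \<equiv> graphical_gens V E v R"

abbreviation "rels \<equiv> graphical_relations V E v R"

lemma gen_image_mem [simp]: "gen_image \<in> gens \<rightarrow> carrier model"
  by (auto simp: gen_image_def graphical_gens_def model_carrier)

lemma XGen_mem [simp]: "XGen i r \<in> gens \<longleftrightarrow> i \<in> {1..card V} \<and> r \<in> carrier R"
  by (auto simp: graphical_gens_def)

lemma ZGen_mem [simp]: "ZGen j k r \<in> gens \<longleftrightarrow> (j, k) \<in> J \<and> r \<in> carrier R"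
  by (auto simp: graphical_gens_def)

lemma adjacent_commute: "adjacent E a b \<longleftrightarrow> adjacent E b a"
  by (simp add: adjacent_def insert_commute)

lemma edge_indices_iff: "(j, k) \<in> J \<longleftrightarrow>
    j \<in> {1..card V} \<and> k \<in> {1..card V} \<and> j < k \<and> adjacent E (v j) (v k)"
  by (auto simp: edge_indices_def)

text \<open>In the model the commutator of (x, s) and (y, t) is 0 in the first component and x_j y_k
  - x_k y_j at (j, k). At the images of the generators this gives exactly the prescribed right-hand
  sides.\<close>

lemma gen_image_rel:
  assumes "(u, w) \<in> rels"
  shows "word_eval model gen_image u = word_eval model gen_image w"
proof -
  interpret M: group model by (rule group_model)
  have closed: "gen_image g \<in> carrier model" if "g \<in> gens" for g
    using that gen_image_mem by blast
  have letter: "word_eval model gen_image (letter g) = gen_image g" if "g \<in> gens" for g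
    using closed[OF that] by (simp add: letter_def)
  have append: "word_eval model gen_image (letter g @ letter h) = gen_image g \<otimes>\<^bsub>model\<^esub> gen_image h"
    if "g \<in> gens" "h \<in> gens" for g h
    using closed[OF that(1)] closed[OF that(2)] by (simp add: letter_def)
  \<comment> \<open>All four commutator relations reduce to this coordinate check. As
    \<open>c\<close> has first component zero it contributes no cocycle term, and its second
    component only has to match the difference of two cocycle terms.\<close>
  have comm: "word_eval model gen_image (word_comm (letter g) (letter h)) = c"
    if "g \<in> gens" "h \<in> gens" "c \<in> carrier model"
      "\<And>p. p \<in> J \<Longrightarrow> \<ominus> (fst (gen_image g) (v (snd p)) \<otimes> fst (gen_image h) (v (fst p))) =
        snd c p \<ominus> fst (gen_image h) (v (snd p)) \<otimes> fst (gen_image g) (v (fst p))"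
      "\<And>a. a \<in> V \<Longrightarrow> fst c a = \<zero>" for g h c
  proof -
    note gh = closed[OF that(1)] closed[OF that(2)]
    have "gen_image g \<otimes>\<^bsub>model\<^esub> gen_image h = gen_image h \<otimes>\<^bsub>model\<^esub> gen_image g \<otimes>\<^bsub>model\<^esub> c"
    proof (rule model_eqI)
      fix p assume p: "p \<in> J"
      have "s \<oplus> t \<ominus> x = t \<oplus> s \<ominus> y \<oplus> d"
        if "\<ominus> x = d \<ominus> y" "s \<in> carrier R" "t \<in> carrier R" "x \<in> carrier R" "y \<in> carrier R"
          "d \<in> carrier R" for s t x y d
        using that(2-) unfolding R.minus_eq[of _ x] that(1) by algebra
      from this[OF that(4)[OF p]] show "snd (gen_image g \<otimes>\<^bsub>model\<^esub> gen_image h) p =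
          snd (gen_image h \<otimes>\<^bsub>model\<^esub> gen_image g \<otimes>\<^bsub>model\<^esub> c) p"
        using that(3,5) gh p by (simp add: model_mult_fst model_mult_snd R.minus_eq)
    qed (use that(3,5) gh in \<open>auto simp: model_mult_fst R.a_comm\<close>)
    then show ?thesis
      using M.word_eval_comm_eq[OF gen_image_mem] that by blast
  qed
  note eval = model_mult_fst model_mult_snd model_one gen_image_def
  show ?thesis
    using assms
  proof cases
    case (x_add i r r')
    then have "gen_image (XGen i r) \<otimes>\<^bsub>model\<^esub> gen_image (XGen i r') = gen_image (XGen i (r \<oplus> r'))"
      by (intro model_eqI model_closed closed) (auto simp: eval R.minus_eq dest: edge_indicesD)
    with x_add show ?thesis by (simp add: append letter)
  next
    case (z_add j k r r')
    then have "gen_image (ZGen j k r) \<otimes>\<^bsub>model\<^esub> gen_image (ZGen j k r') = gen_image (ZGen j k (r \<oplus> r'))"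
      by (intro model_eqI model_closed closed) (auto simp: eval R.minus_eq)
    with z_add show ?thesis by (simp add: append letter)
  next
    case (x_comm_adjacent j k r r')
    note mem = edge_indicesD[OF x_comm_adjacent(3)]
    have "word_eval model gen_image u = gen_image (ZGen j k (r \<otimes> r'))"
      unfolding x_comm_adjacent(1) using x_comm_adjacent mem
      by (intro comm closed) (auto simp: gen_image_def R.minus_eq R.m_comm R.r_neg dest!: edge_indicesD)
    with x_comm_adjacent show ?thesis by (simp add: letter)
  next
    case (x_comm_nonadjacent i i' r r')
    \<comment> \<open>\<open>gen_image\<close> compares vertices, so equal vertices are traced back
      to equal indices. For \<open>i = i'\<close> both cocycle terms vanish, since the two indices
      of a pair in \<open>J\<close> differ.\<close>
    have "i = i'" if "v i = v i'"
      using x_comm_nonadjacent that by simp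
    then have "word_eval model gen_image u = \<one>\<^bsub>model\<^esub>"
      unfolding x_comm_nonadjacent(1) using x_comm_nonadjacent
      by (intro comm)
        (auto simp: gen_image_def model_one R.minus_eq edge_indices_iff R.m_comm adjacent_commute)
    with x_comm_nonadjacent show ?thesis by simp
  next
    case (xz_comm i j k r r')
    then have "word_eval model gen_image u = \<one>\<^bsub>model\<^esub>"
      unfolding xz_comm(1)
      by (intro comm) (auto simp: gen_image_def model_one R.minus_eq)
    with xz_comm show ?thesis by simp
  next
    case (zz_comm j' k' j k r r')
    then have "word_eval model gen_image u = \<one>\<^bsub>model\<^esub>"
      unfolding zz_comm(1)
      by (intro comm) (auto simp: gen_image_def model_one R.minus_eq)
    with zz_comm show ?thesis by simp
  qed
qed

end

section \<open>Commutation rules in the presented group\<close>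

lemma (in group) left_commute:
  assumes "a \<in> carrier G" "b \<in> carrier G" "c \<in> carrier G" "a \<otimes> b = b \<otimes> a"
  shows "a \<otimes> (b \<otimes> c) = b \<otimes> (a \<otimes> c)"
  using assms(4) by (simp add: m_assoc[symmetric] assms(1-3))

text \<open>The relations give a commutation rule only for j < k; this converts it to the opposite
  order, with the inverse \<open>d\<close> of the correction \<open>c\<close> as the new
  correction.\<close>

lemma (in group) commute_rev:
  assumes "a \<in> carrier G" "b \<in> carrier G" "c \<in> carrier G" "d \<in> carrier G"
    and "a \<otimes> b = b \<otimes> a \<otimes> c" "c \<otimes> d = \<one>"
  shows "b \<otimes> a = a \<otimes> b \<otimes> d"
proof -
  have "b \<otimes> a = b \<otimes> a \<otimes> (c \<otimes> d)"
    using assms by simp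
  also have "\<dots> = b \<otimes> a \<otimes> c \<otimes> d"
    by (rule m_assoc[symmetric]) (simp_all add: assms(1-4))
  finally show ?thesis
    by (simp add: assms(5))
qed

text \<open>One step of collection: \<open>a\<close> is moved past \<open>b\<close> at the cost of
  \<open>z\<close>, and \<open>z\<close> is pushed through \<open>x\<close> to join the tail
  \<open>c\<close>.\<close>

lemma (in group) commute_central:
  assumes "a \<in> carrier G" "b \<in> carrier G" "x \<in> carrier G" "c \<in> carrier G" "z \<in> carrier G"
    and "a \<otimes> b = b \<otimes> a \<otimes> z" "z \<otimes> x = x \<otimes> z"
  shows "a \<otimes> (b \<otimes> x \<otimes> c) = b \<otimes> (a \<otimes> (x \<otimes> (z \<otimes> c)))"
proof -
  have "a \<otimes> (b \<otimes> x \<otimes> c) = a \<otimes> b \<otimes> (x \<otimes> c)"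
    by (simp add: m_assoc assms(1-5))
  also have "\<dots> = b \<otimes> (a \<otimes> (z \<otimes> x \<otimes> c))"
    unfolding assms(6) by (simp add: m_assoc assms(1-5))
  also have "\<dots> = b \<otimes> (a \<otimes> (x \<otimes> (z \<otimes> c)))"
    unfolding assms(7) by (simp add: m_assoc assms(1-5))
  finally show ?thesis .
qed

context graphical
begin

abbreviation "cls \<equiv> \<lambda>w. word_cong gens rels `` {w}"

abbreviation "XG i r \<equiv> cls (x_letter i r)"

abbreviation "ZG p r \<equiv> cls (z_letter (fst p) (snd p) r)"

lemma group_GG: "group GG"
  by (simp add: graphical_group_def group_presented_group)

sublocale G: group GG
  by (rule group_GG)

lemma cls_mult: "u \<in> words gens \<Longrightarrow> w \<in> words gens \<Longrightarrow> cls u \<otimes>\<^bsub>GG\<^esub> cls w = cls (u @ w)"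
  by (simp add: graphical_group_def presented_group_mult)

lemma cls_closed [simp]: "w \<in> words gens \<Longrightarrow> cls w \<in> carrier GG"
  by (auto simp: graphical_group_def presented_group_def quotient_def)

lemma cls_Nil: "cls [] = \<one>\<^bsub>GG\<^esub>"
  by (simp add: graphical_group_def presented_group_def)

lemma letter_words [simp]: "letter g \<in> words S \<longleftrightarrow> g \<in> S"
  by (simp add: letter_def)

lemma cls_relation: "(u, w) \<in> rels \<Longrightarrow> u \<in> words gens \<Longrightarrow> w \<in> words gens \<Longrightarrow> cls u = cls w"
  by (intro equiv_class_eq[OF equiv_word_cong] word_cong.relation)

lemma cls_comm:
  assumes "(word_comm (letter g) (letter h), w) \<in> rels" "g \<in> gens" "h \<in> gens" "w \<in> words gens"
  shows "cls (letter g) \<otimes>\<^bsub>GG\<^esub> cls (letter h) = cls (letter h) \<otimes>\<^bsub>GG\<^esub> cls (letter g) \<otimes>\<^bsub>GG\<^esub> cls w"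
  using presented_group_comm[OF assms] by (simp add: graphical_group_def)

lemma ZG_letter_mem [simp]: "ZGen (fst p) (snd p) r \<in> gens \<longleftrightarrow> p \<in> J \<and> r \<in> carrier R"
  by simp

lemma XG_add:
  assumes "i \<in> {1..card V}" "r \<in> carrier R" "r' \<in> carrier R"
  shows "XG i r \<otimes>\<^bsub>GG\<^esub> XG i r' = XG i (r \<oplus> r')"
  using cls_relation[OF graphical_relations.x_add[OF assms]] assms by (simp add: cls_mult)

lemma ZG_add:
  assumes "p \<in> J" "r \<in> carrier R" "r' \<in> carrier R"
  shows "ZG p r \<otimes>\<^bsub>GG\<^esub> ZG p r' = ZG p (r \<oplus> r')"
  using cls_relation[OF graphical_relations.z_add[of "fst p" "snd p", simplified, OF assms]] assms
  by (simp add: cls_mult)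

lemma XG_closed [simp]: "i \<in> {1..card V} \<Longrightarrow> r \<in> carrier R \<Longrightarrow> XG i r \<in> carrier GG"
  by simp

lemma ZG_closed [simp]: "p \<in> J \<Longrightarrow> r \<in> carrier R \<Longrightarrow> ZG p r \<in> carrier GG"
  by simp

lemma XG_zero: "i \<in> {1..card V} \<Longrightarrow> XG i \<zero> = \<one>\<^bsub>GG\<^esub>"
  using XG_add[of i \<zero> \<zero>] G.l_cancel_one'[of "XG i \<zero>" "XG i \<zero>"] by auto

lemma ZG_zero: "p \<in> J \<Longrightarrow> ZG p \<zero> = \<one>\<^bsub>GG\<^esub>"
  using ZG_add[of p \<zero> \<zero>] G.l_cancel_one'[of "ZG p \<zero>" "ZG p \<zero>"] by auto

lemma ZG_XG:
  assumes "p \<in> J" "i \<in> {1..card V}" "r \<in> carrier R" "r' \<in> carrier R"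
  shows "ZG p r' \<otimes>\<^bsub>GG\<^esub> XG i r = XG i r \<otimes>\<^bsub>GG\<^esub> ZG p r'"
  using cls_comm[OF graphical_relations.xz_comm[of i V "fst p" "snd p", simplified, OF _ assms(1,3,4)]] assms
  by (simp add: cls_Nil)

lemma ZG_ZG:
  assumes "p \<in> J" "p' \<in> J" "r \<in> carrier R" "r' \<in> carrier R"
  shows "ZG p r \<otimes>\<^bsub>GG\<^esub> ZG p' r' = ZG p' r' \<otimes>\<^bsub>GG\<^esub> ZG p r"
  using cls_comm[OF graphical_relations.zz_comm[of "fst p" "snd p" V E v "fst p'" "snd p'", simplified, OF assms]] assms
  by (simp add: cls_Nil)

lemma XG_XG_adjacent:
  assumes "(j, k) \<in> J" "r \<in> carrier R" "r' \<in> carrier R"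
  shows "XG j r \<otimes>\<^bsub>GG\<^esub> XG k r' = XG k r' \<otimes>\<^bsub>GG\<^esub> XG j r \<otimes>\<^bsub>GG\<^esub> ZG (j, k) (r \<otimes> r')"
  using cls_comm[OF graphical_relations.x_comm_adjacent[OF assms]] assms edge_indicesD[of "(j, k)"]
  by simp

lemma XG_XG_nonadjacent:
  assumes "i \<in> {1..card V}" "i' \<in> {1..card V}" "\<not> adjacent E (v i) (v i')"
    "r \<in> carrier R" "r' \<in> carrier R"
  shows "XG i r \<otimes>\<^bsub>GG\<^esub> XG i' r' = XG i' r' \<otimes>\<^bsub>GG\<^esub> XG i r"
  using cls_comm[OF graphical_relations.x_comm_nonadjacent[OF assms]] assms
  by (simp add: cls_Nil)

text \<open>For an edge with \<open>i < h\<close> this is the adjacent rule itself; for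
  \<open>h < i\<close> the rule is reversed and the correction has coefficient -(s r). Its exact
  value is forgotten because collection only uses that it is central.\<close>

lemma XG_XG:
  assumes "i \<in> {1..card V}" "h \<in> {1..card V}" "i \<noteq> h" "r \<in> carrier R" "s \<in> carrier R"
  obtains "XG i r \<otimes>\<^bsub>GG\<^esub> XG h s = XG h s \<otimes>\<^bsub>GG\<^esub> XG i r"
  | p t where "p \<in> J" "t \<in> carrier R"
    "XG i r \<otimes>\<^bsub>GG\<^esub> XG h s = XG h s \<otimes>\<^bsub>GG\<^esub> XG i r \<otimes>\<^bsub>GG\<^esub> ZG p t"
proof (cases "adjacent E (v i) (v h)")
  case False
  show ?thesis
    by (rule that(1)[OF XG_XG_nonadjacent[OF assms(1,2) False assms(4,5)]])
next
  case True
  show ?thesis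
  proof (cases "i < h")
    case True
    then have p: "(i, h) \<in> J" using assms \<open>adjacent E (v i) (v h)\<close> by (simp add: edge_indices_iff)
    show ?thesis
      by (rule that(2)[OF p R.m_closed[OF assms(4,5)] XG_XG_adjacent[OF p assms(4,5)]])
  next
    case False
    then have p: "(h, i) \<in> J"
      using assms \<open>adjacent E (v i) (v h)\<close> by (simp add: edge_indices_iff adjacent_commute)
    have rs: "s \<otimes> r \<in> carrier R" "\<ominus> (s \<otimes> r) \<in> carrier R" using assms by auto
    have "ZG (h, i) (s \<otimes> r) \<otimes>\<^bsub>GG\<^esub> ZG (h, i) (\<ominus> (s \<otimes> r)) = \<one>\<^bsub>GG\<^esub>"
      unfolding ZG_add[OF p rs] R.r_neg[OF rs(1)] by (rule ZG_zero[OF p])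
    from G.commute_rev[OF XG_closed[OF assms(2,5)] XG_closed[OF assms(1,4)] ZG_closed[OF p rs(1)]
        ZG_closed[OF p rs(2)] XG_XG_adjacent[OF p assms(5,4)] this]
    show ?thesis by (rule that(2)[OF p rs(2)])
  qed
qed

section \<open>Collection into normal forms\<close>

definition xprod :: "nat list \<Rightarrow> (nat \<Rightarrow> 'a) \<Rightarrow> 'a graphical_gen word set"
  where "xprod l x = foldr (\<lambda>i a. XG i (x i) \<otimes>\<^bsub>GG\<^esub> a) l \<one>\<^bsub>GG\<^esub>"

definition zprod :: "(nat \<times> nat) list \<Rightarrow> (nat \<times> nat \<Rightarrow> 'a) \<Rightarrow> 'a graphical_gen word set"
  where "zprod l s = foldr (\<lambda>p a. ZG p (s p) \<otimes>\<^bsub>GG\<^esub> a) l \<one>\<^bsub>GG\<^esub>"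

lemma xprod_simps [simp]:
  "xprod [] x = \<one>\<^bsub>GG\<^esub>" "xprod (i # l) x = XG i (x i) \<otimes>\<^bsub>GG\<^esub> xprod l x"
  by (simp_all add: xprod_def)

lemma zprod_simps [simp]:
  "zprod [] s = \<one>\<^bsub>GG\<^esub>" "zprod (p # l) s = ZG p (s p) \<otimes>\<^bsub>GG\<^esub> zprod l s"
  by (simp_all add: zprod_def)

lemma xprod_cong: "(\<And>i. i \<in> set l \<Longrightarrow> x i = y i) \<Longrightarrow> xprod l x = xprod l y"
  by (induction l) auto

lemma zprod_cong: "(\<And>i. i \<in> set l \<Longrightarrow> x i = y i) \<Longrightarrow> zprod l x = zprod l y"
  by (induction l) auto

lemma xprod_closed [simp]:
  "set l \<subseteq> {1..card V} \<Longrightarrow> x \<in> set l \<rightarrow> carrier R \<Longrightarrow> xprod l x \<in> carrier GG"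
  by (induction l) auto

lemma zprod_closed [simp]:
  "set l \<subseteq> J \<Longrightarrow> s \<in> set l \<rightarrow> carrier R \<Longrightarrow> zprod l s \<in> carrier GG"
  by (induction l) auto

lemma xprod_zero: "set l \<subseteq> {1..card V} \<Longrightarrow> (\<And>i. i \<in> set l \<Longrightarrow> x i = \<zero>) \<Longrightarrow> xprod l x = \<one>\<^bsub>GG\<^esub>"
  by (induction l) (auto simp: XG_zero)

lemma zprod_zero: "set l \<subseteq> J \<Longrightarrow> (\<And>p. p \<in> set l \<Longrightarrow> s p = \<zero>) \<Longrightarrow> zprod l s = \<one>\<^bsub>GG\<^esub>"
  by (induction l) (auto simp: ZG_zero)

lemma ZG_xprod:
  assumes "p \<in> J" "r \<in> carrier R" "set l \<subseteq> {1..card V}" "x \<in> set l \<rightarrow> carrier R"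
  shows "ZG p r \<otimes>\<^bsub>GG\<^esub> xprod l x = xprod l x \<otimes>\<^bsub>GG\<^esub> ZG p r"
  using assms(3,4)
proof (induction l)
  case (Cons i l)
  then have i: "i \<in> {1..card V}" "x i \<in> carrier R" and l: "xprod l x \<in> carrier GG"
    and IH: "ZG p r \<otimes>\<^bsub>GG\<^esub> xprod l x = xprod l x \<otimes>\<^bsub>GG\<^esub> ZG p r" by auto
  have "ZG p r \<otimes>\<^bsub>GG\<^esub> (XG i (x i) \<otimes>\<^bsub>GG\<^esub> xprod l x) = XG i (x i) \<otimes>\<^bsub>GG\<^esub> (ZG p r \<otimes>\<^bsub>GG\<^esub> xprod l x)"
    by (rule G.left_commute[OF ZG_closed[OF assms(1,2)] XG_closed[OF i] l ZG_XG[OF assms(1) i assms(2)]])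
  then show ?case
    using assms(1,2) i l IH by (simp add: G.m_assoc)
qed (use assms in simp)

text \<open>All factors commute, so the new one travels to the slot with its own index and is
  absorbed there by additivity. Distinctness of \<open>l\<close> ensures that the updated
  coefficient affects a single slot.\<close>

lemma ZG_zprod:
  assumes "p \<in> set l" "distinct l" "set l \<subseteq> J" "s \<in> set l \<rightarrow> carrier R" "r \<in> carrier R"
  shows "ZG p r \<otimes>\<^bsub>GG\<^esub> zprod l s = zprod l (s(p := r \<oplus> s p))"
  using assms(1-4)
proof (induction l)
  case (Cons h l)
  then have h: "h \<in> J" "s h \<in> carrier R" "p \<in> J" and l: "zprod l s \<in> carrier GG" by auto
  show ?case
  proof (cases "p = h")
    case True
    then have "zprod l (s(p := r \<oplus> s p)) = zprod l s"
      using Cons.prems by (intro zprod_cong) auto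
    then show ?thesis
      unfolding True zprod_simps fun_upd_same
      using h l assms(5) ZG_add[of h r "s h"] True by (simp only: G.m_assoc[symmetric] ZG_closed)
  next
    case False
    then have IH: "ZG p r \<otimes>\<^bsub>GG\<^esub> zprod l s = zprod l (s(p := r \<oplus> s p))"
      using Cons.prems by (intro Cons.IH) auto
    have "ZG p r \<otimes>\<^bsub>GG\<^esub> (ZG h (s h) \<otimes>\<^bsub>GG\<^esub> zprod l s) = ZG h (s h) \<otimes>\<^bsub>GG\<^esub> (ZG p r \<otimes>\<^bsub>GG\<^esub> zprod l s)"
      by (rule G.left_commute[OF ZG_closed[OF h(3) assms(5)] ZG_closed[OF h(1,2)] l
          ZG_ZG[OF h(3,1) assms(5) h(2)]])
    then show ?thesis using IH False by (simp del: fun_upd_apply add: fun_upd_same fun_upd_other)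
  qed
qed simp

text \<open>The possible central tails of a normal form. The enumeration of \<open>J\<close> is
  existential so that no fixed order of the edges has to be carried along.\<close>

definition Zpart :: "'a graphical_gen word set set"
  where "Zpart = {zprod l s | l s. distinct l \<and> set l = J \<and> s \<in> J \<rightarrow> carrier R}"

lemma Zpart_closed [simp]: "c \<in> Zpart \<Longrightarrow> c \<in> carrier GG"
  by (auto simp: Zpart_def)

lemma one_Zpart: "\<one>\<^bsub>GG\<^esub> \<in> Zpart"
proof -
  obtain l where "distinct l" "set l = J" using finite_distinct_list[OF finite_J] by blast
  then show ?thesis
    using zprod_zero[of l "\<lambda>_. \<zero>"] unfolding Zpart_def
    by (intro CollectI exI[of _ l] exI[of _ "\<lambda>_. \<zero>"]) auto
qed

lemma ZG_Zpart:
  assumes "p \<in> J" "r \<in> carrier R" "c \<in> Zpart"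
  shows "ZG p r \<otimes>\<^bsub>GG\<^esub> c \<in> Zpart"
proof -
  obtain l s where l: "c = zprod l s" "distinct l" "set l = J" "s \<in> J \<rightarrow> carrier R"
    using assms(3) by (auto simp: Zpart_def)
  have "ZG p r \<otimes>\<^bsub>GG\<^esub> c = zprod l (s(p := r \<oplus> s p))"
    unfolding l(1) using l assms by (intro ZG_zprod) auto
  moreover have "s(p := r \<oplus> s p) \<in> J \<rightarrow> carrier R"
    using l(4) assms by (simp add: Pi_iff)
  ultimately show ?thesis
    using l unfolding Zpart_def by blast
qed

text \<open>The new factor is moved rightwards to its own slot. Each swap costs at most one central
  factor, which passes through the remaining product and is absorbed by the tail; this is why
  \<open>c\<close> varies in the induction.\<close>

lemma XG_xprod:
  assumes "i \<in> set l" "distinct l" "set l \<subseteq> {1..card V}" "x \<in> set l \<rightarrow> carrier R"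
    "r \<in> carrier R" "c \<in> Zpart"
  shows "\<exists>y\<in>set l \<rightarrow> carrier R. \<exists>d\<in>Zpart.
    XG i r \<otimes>\<^bsub>GG\<^esub> (xprod l x \<otimes>\<^bsub>GG\<^esub> c) = xprod l y \<otimes>\<^bsub>GG\<^esub> d"
  using assms(1-4,6)
proof (induction l arbitrary: c)
  case (Cons h l)
  then have h: "h \<in> {1..card V}" "x h \<in> carrier R" "i \<in> {1..card V}"
    and l: "xprod l x \<in> carrier GG" "set l \<subseteq> {1..card V}" "x \<in> set l \<rightarrow> carrier R"
    and c: "c \<in> carrier GG" by auto
  note XG [simp] = XG_closed[OF h(1,2)] XG_closed[OF h(3) assms(5)]
  show ?case
  proof (cases "i = h")
    case True
    have "xprod l (x(h := r \<oplus> x h)) = xprod l x"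
      using Cons.prems by (intro xprod_cong) auto
    moreover have "XG h r \<otimes>\<^bsub>GG\<^esub> (XG h (x h) \<otimes>\<^bsub>GG\<^esub> xprod l x \<otimes>\<^bsub>GG\<^esub> c) =
        XG h (r \<oplus> x h) \<otimes>\<^bsub>GG\<^esub> xprod l x \<otimes>\<^bsub>GG\<^esub> c"
      using XG_add[OF h(1) assms(5) h(2)] True XG l(1) c by (simp add: G.m_assoc[symmetric])
    ultimately have "XG i r \<otimes>\<^bsub>GG\<^esub> (xprod (h # l) x \<otimes>\<^bsub>GG\<^esub> c) =
        xprod (h # l) (x(h := r \<oplus> x h)) \<otimes>\<^bsub>GG\<^esub> c"
      using True by (simp del: fun_upd_apply add: fun_upd_same fun_upd_other)
    moreover have "x(h := r \<oplus> x h) \<in> set (h # l) \<rightarrow> carrier R"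
      using Cons.prems(4) h(2) assms(5) by (simp add: Pi_iff)
    ultimately show ?thesis using Cons.prems(5) by blast
  next
    case False
    \<comment> \<open>Here \<open>d\<close> is \<open>c\<close> when the two factors commute, and
      the correction times \<open>c\<close> otherwise.\<close>
    have "\<exists>d\<in>Zpart. XG i r \<otimes>\<^bsub>GG\<^esub> (XG h (x h) \<otimes>\<^bsub>GG\<^esub> xprod l x \<otimes>\<^bsub>GG\<^esub> c) =
        XG h (x h) \<otimes>\<^bsub>GG\<^esub> (XG i r \<otimes>\<^bsub>GG\<^esub> (xprod l x \<otimes>\<^bsub>GG\<^esub> d))"
    proof (rule XG_XG[OF h(3,1) False assms(5) h(2)])
      assume *: "XG i r \<otimes>\<^bsub>GG\<^esub> XG h (x h) = XG h (x h) \<otimes>\<^bsub>GG\<^esub> XG i r"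
      have "XG i r \<otimes>\<^bsub>GG\<^esub> (XG h (x h) \<otimes>\<^bsub>GG\<^esub> xprod l x \<otimes>\<^bsub>GG\<^esub> c) =
          XG h (x h) \<otimes>\<^bsub>GG\<^esub> (XG i r \<otimes>\<^bsub>GG\<^esub> (xprod l x \<otimes>\<^bsub>GG\<^esub> c))"
        unfolding G.m_assoc[OF XG(1) l(1) c]
        by (rule G.left_commute[OF XG(2,1) G.m_closed[OF l(1) c] *])
      then show ?thesis
        using Cons.prems(5) by blast
    next
      fix p t assume p: "p \<in> J" "t \<in> carrier R"
        and *: "XG i r \<otimes>\<^bsub>GG\<^esub> XG h (x h) = XG h (x h) \<otimes>\<^bsub>GG\<^esub> XG i r \<otimes>\<^bsub>GG\<^esub> ZG p t"
      show ?thesis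
        using G.commute_central[OF XG(2,1) l(1) c ZG_closed[OF p] * ZG_xprod[OF p l(2,3)]]
          ZG_Zpart[OF p Cons.prems(5)] by blast
    qed
    then obtain d where d: "d \<in> Zpart" "XG i r \<otimes>\<^bsub>GG\<^esub> (XG h (x h) \<otimes>\<^bsub>GG\<^esub> xprod l x \<otimes>\<^bsub>GG\<^esub> c) =
        XG h (x h) \<otimes>\<^bsub>GG\<^esub> (XG i r \<otimes>\<^bsub>GG\<^esub> (xprod l x \<otimes>\<^bsub>GG\<^esub> d))" by blast
    obtain y e where ye: "y \<in> set l \<rightarrow> carrier R" "e \<in> Zpart"
        "XG i r \<otimes>\<^bsub>GG\<^esub> (xprod l x \<otimes>\<^bsub>GG\<^esub> d) = xprod l y \<otimes>\<^bsub>GG\<^esub> e"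
      using Cons.IH[OF _ _ l(2,3) d(1)] Cons.prems False by auto
    \<comment> \<open>Nothing is known about \<open>y\<close> at the head \<open>h\<close>, which
      does not occur in \<open>l\<close>; the old coefficient \<open>x h\<close> is reinstated
      there.\<close>
    have eq: "xprod l (y(h := x h)) = xprod l y"
      using Cons.prems by (intro xprod_cong) auto
    show ?thesis
    proof (intro bexI)
      show "XG i r \<otimes>\<^bsub>GG\<^esub> (xprod (h # l) x \<otimes>\<^bsub>GG\<^esub> c) = xprod (h # l) (y(h := x h)) \<otimes>\<^bsub>GG\<^esub> e"
        using d(2) ye eq XG l by (simp add: G.m_assoc)
    qed (use ye h in auto)
  qed
qed simp

text \<open>From x_i(-r) x_i(r) = x_i(0) = 1 the inverse of a generator is again a generator, and
  likewise for the central ones. Hence positive letters suffice.\<close>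

lemma letter_cases:
  assumes "g \<in> gens"
  obtains i r where "i \<in> {1..card V}" "r \<in> carrier R" "cls [(g, b)] = XG i r"
  | p r where "p \<in> J" "r \<in> carrier R" "cls [(g, b)] = ZG p r"
proof -
  have inv: "cls [(g, True)] = a" if "a \<otimes>\<^bsub>GG\<^esub> cls (letter g) = \<one>\<^bsub>GG\<^esub>" "a \<in> carrier GG" for a
  proof -
    have "cls (letter g) \<otimes>\<^bsub>GG\<^esub> cls [(g, True)] = cls []"
      using assms cls_mult[of "letter g" "[(g, True)]"]
        equiv_class_eq[OF equiv_word_cong word_cong.cancel[OF assms, of False]]
      by (simp add: letter_def)
    then show ?thesis
      using G.inv_unique[of a "cls (letter g)" "cls [(g, True)]"] that assms by (simp add: cls_Nil)
  qed
  consider (X) i r where "g = XGen i r" "i \<in> {1..card V}" "r \<in> carrier R"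
    | (Z) p r where "g = ZGen (fst p) (snd p) r" "p \<in> J" "r \<in> carrier R"
    using assms by (auto simp: graphical_gens_def)
  then show ?thesis
  proof cases
    case X
    then have "cls [(g, b)] = XG i (if b then \<ominus> r else r)"
      using inv[of "XG i (\<ominus> r)"] XG_add[of i "\<ominus> r" r] XG_zero[of i]
      by (auto simp: R.l_neg letter_def)
    then show ?thesis using X by (intro that(1)[of i "if b then \<ominus> r else r"]) auto
  next
    case Z
    then have "cls [(g, b)] = ZG p (if b then \<ominus> r else r)"
      using inv[of "ZG p (\<ominus> r)"] ZG_add[of p "\<ominus> r" r] ZG_zero[of p]
      by (auto simp: R.l_neg letter_def)
    then show ?thesis using Z by (intro that(2)[of p "if b then \<ominus> r else r"]) auto
  qed
qed

text \<open>Elements of this form include the identity and are stable under left multiplication by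
  every letter, so they exhaust the group. Only existence is claimed; the independence of the
  coefficients becomes visible in the model.\<close>

lemma normal_form:
  assumes "a \<in> carrier GG" "distinct l" "set l = {1..card V}"
  shows "\<exists>x\<in>{1..card V} \<rightarrow> carrier R. \<exists>c\<in>Zpart. a = xprod l x \<otimes>\<^bsub>GG\<^esub> c"
  using assms(1) unfolding graphical_group_def
proof (induction rule: presented_group_induct)
  case one
  then show ?case
    using xprod_zero[of l "\<lambda>_. \<zero>"] one_Zpart assms
    by (intro bexI[of _ "\<lambda>_. \<zero>"] bexI[of _ "\<one>\<^bsub>GG\<^esub>"]) (auto simp: graphical_group_def[symmetric])
next
  case (mult g b a)
  then obtain x c where xc: "x \<in> {1..card V} \<rightarrow> carrier R" "c \<in> Zpart" "a = xprod l x \<otimes>\<^bsub>GG\<^esub> c"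
    by (auto simp: graphical_group_def[symmetric])
  show ?case
    unfolding graphical_group_def[symmetric]
  proof (rule letter_cases[OF mult(1), of b])
    fix i r assume "i \<in> {1..card V}" "r \<in> carrier R" "cls [(g, b)] = XG i r"
    then show "\<exists>x\<in>{1..card V} \<rightarrow> carrier R. \<exists>c\<in>Zpart. cls [(g, b)] \<otimes>\<^bsub>GG\<^esub> a = xprod l x \<otimes>\<^bsub>GG\<^esub> c"
      using XG_xprod[of i l x r c] assms xc by auto
  next
    fix p r assume p: "p \<in> J" "r \<in> carrier R" "cls [(g, b)] = ZG p r"
    have "ZG p r \<otimes>\<^bsub>GG\<^esub> a = xprod l x \<otimes>\<^bsub>GG\<^esub> (ZG p r \<otimes>\<^bsub>GG\<^esub> c)"
      using ZG_xprod[OF p(1,2), of l x] xc assms p(1,2) ZG_closed[OF p(1,2)]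
      by (simp add: G.m_assoc[symmetric])
    then show "\<exists>x\<in>{1..card V} \<rightarrow> carrier R. \<exists>c\<in>Zpart. cls [(g, b)] \<otimes>\<^bsub>GG\<^esub> a = xprod l x \<otimes>\<^bsub>GG\<^esub> c"
      using ZG_Zpart[OF p(1,2) xc(2)] xc(1) p(3) by auto
  qed
qed

text \<open>The images of the generators satisfy the relations, which gives a homomorphism. Its
  value at a normal form reveals the coefficients, first those of the \<open>xprod\<close> factor
  and, once these vanish, those of the central tail, so the kernel is trivial. Solving for the
  coefficients in the same order gives surjectivity.\<close>

theorem graphical_group_iso: "\<exists>\<phi>. \<phi> \<in> iso GG model"
proof -
  interpret M: group model by (rule group_model)
  obtain \<phi> where hom: "\<phi> \<in> hom GG model"
    and \<phi>: "\<And>u. u \<in> words gens \<Longrightarrow> \<phi> (cls u) = word_eval model gen_image u"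
    unfolding graphical_group_def
    using M.presented_group_hom[OF gen_image_mem gen_image_rel] by blast
  interpret \<phi>: group_hom GG model \<phi>
    by unfold_locales (rule hom)
  have \<phi>_letter: "\<phi> (cls (letter g)) = gen_image g" if "g \<in> gens" for g
  proof -
    have "gen_image g \<in> carrier model" using gen_image_mem that by blast
    then show ?thesis using that by (simp add: \<phi>) (simp add: letter_def)
  qed
  \<comment> \<open>Only the first component is tracked: it is additive, whereas the second picks up
    cocycle terms that depend on the order of \<open>l\<close>.\<close>
  have \<phi>_xprod: "fst (\<phi> (xprod l x)) (v i) = (if i \<in> set l then x i else \<zero>)"
    if "distinct l" "set l \<subseteq> {1..card V}" "x \<in> set l \<rightarrow> carrier R" "i \<in> {1..card V}" for l x i
    using that(1-3)
  proof (induction l)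
    case Nil
    then show ?case using that(4) by (simp add: model_one)
  next
    case (Cons h l)
    have "\<phi> (xprod (h # l) x) = gen_image (XGen h (x h)) \<otimes>\<^bsub>model\<^esub> \<phi> (xprod l x)"
      using Cons.prems by (simp add: \<phi>_letter)
    then show ?case
      using Cons that(4) by (auto simp: model_mult_fst gen_image_def Pi_iff)
  qed
  have \<phi>_zprod: "fst (\<phi> (zprod l s)) = (\<lambda>a\<in>V. \<zero>) \<and>
      (\<forall>p\<in>J. snd (\<phi> (zprod l s)) p = (if p \<in> set l then s p else \<zero>))"
    if "distinct l" "set l \<subseteq> J" "s \<in> set l \<rightarrow> carrier R" for l s
    using that
  proof (induction l)
    case Nil
    then show ?case by (simp add: model_one)
  next
    case (Cons h l)
    have "\<phi> (zprod (h # l) s) = gen_image (ZGen (fst h) (snd h) (s h)) \<otimes>\<^bsub>model\<^esub> \<phi> (zprod l s)"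
      using Cons.prems by (simp add: \<phi>_letter)
    then show ?case
      using Cons by (auto simp: model_mult_fst model_mult_snd gen_image_def R.minus_eq Pi_iff)
  qed
  obtain li where li: "distinct li" "set li = {1..card V}"
    using finite_distinct_list[of "{1..card V}"] by blast
  have "inj_on \<phi> (carrier GG)"
    unfolding \<phi>.inj_on_one_iff
  proof (intro ballI impI allI)
    fix a assume a: "a \<in> carrier GG" "\<phi> a = \<one>\<^bsub>model\<^esub>"
    obtain x c where x: "x \<in> {1..card V} \<rightarrow> carrier R" and "c \<in> Zpart"
      and a_eq: "a = xprod li x \<otimes>\<^bsub>GG\<^esub> c"
      using normal_form[OF a(1) li] by blast
    then obtain lj s where lj: "distinct lj" "set lj = J" and s: "s \<in> J \<rightarrow> carrier R"
      and c: "c = zprod lj s"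
      by (auto simp: Zpart_def)
    have mem: "xprod li x \<in> carrier GG" "c \<in> carrier GG"
      using x li lj s by (simp_all add: c)
    have "x i = \<zero>" if i: "i \<in> {1..card V}" for i
    proof -
      have "fst (\<phi> a) (v i) = x i \<oplus> \<zero>"
        using \<phi>_xprod[of li x i] \<phi>_zprod[of lj s] mem x s li lj i
        by (simp add: a_eq c model_mult_fst)
      then show ?thesis
        using a(2) x i by (auto simp: model_one Pi_iff)
    qed
    then have "xprod li x = \<one>\<^bsub>GG\<^esub>"
      using li by (intro xprod_zero) auto
    then have ac: "a = c" using mem a_eq by simp
    have "s p = \<zero>" if "p \<in> J" for p
      using a(2) \<phi>_zprod[of lj s] lj s that by (simp add: ac c model_one)
    then show "a = \<one>\<^bsub>GG\<^esub>"
      unfolding ac c using lj by (intro zprod_zero) auto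
  qed
  moreover have "\<phi> ` carrier GG = carrier model"
  proof
    show "carrier model \<subseteq> \<phi> ` carrier GG"
    proof
      fix m assume m: "m \<in> carrier model"
      obtain lj where lj: "distinct lj" "set lj = J"
        using finite_distinct_list[OF finite_J] by blast
      define x where "x i = fst m (v i)" for i
      have x: "x \<in> set li \<rightarrow> carrier R" using m li by (auto simp: x_def)
      define b where "b = xprod li x"
      have b: "b \<in> carrier GG" using x li by (simp add: b_def)
      have \<phi>b: "\<phi> b \<in> carrier model" using b by simp
      \<comment> \<open>The enumeration \<open>li\<close> is arbitrary, so \<open>\<phi> b\<close>
        may have a nonzero second component; the central factor supplies what it lacks compared with
        \<open>m\<close>.\<close>
      define s where "s p = snd m p \<ominus> snd (\<phi> b) p" for p
      have s: "s \<in> set lj \<rightarrow> carrier R" using m \<phi>b lj by (auto simp: s_def)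
      have z: "zprod lj s \<in> carrier GG" using s lj by simp
      have "\<phi> (b \<otimes>\<^bsub>GG\<^esub> zprod lj s) = m"
      proof (rule model_eqI)
        fix a assume "a \<in> V"
        then obtain i where i: "i \<in> {1..card V}" "a = v i"
          using bij_betw_imp_surj_on[OF enum] by blast
        then show "fst (\<phi> (b \<otimes>\<^bsub>GG\<^esub> zprod lj s)) a = fst m a"
          using \<phi>_zprod[of lj s] \<phi>_xprod[of li x i] b z s x li lj m
          by (simp add: model_mult_fst b_def[symmetric] x_def)
      next
        fix p assume p: "p \<in> J"
        have "t \<oplus> (u \<ominus> t) \<ominus> \<zero> = u"
          if "t \<in> carrier R" "u \<in> carrier R" for t u
          using that by algebra
        from this[of "snd (\<phi> b) p" "snd m p"] show "snd (\<phi> (b \<otimes>\<^bsub>GG\<^esub> zprod lj s)) p = snd m p"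
          using \<phi>_zprod[of lj s] b z s lj m p \<phi>b by (simp add: model_mult_snd s_def)
      qed (use b z m in simp_all)
      then show "m \<in> \<phi> ` carrier GG" using b z by (metis G.m_closed image_eqI)
    qed
  qed auto
  ultimately show ?thesis
    using hom unfolding iso_def bij_betw_def by blast
qed

end

section \<open>Burnside's lemma for the conjugation action\<close>

lemma (in group) card_conjugacy_classes:
  assumes "finite (carrier G)"
  shows "card (conjugacy_classes G) * card (carrier G) =
    (\<Sum>g\<in>carrier G. card {h \<in> carrier G. g \<otimes> h = h \<otimes> g})"
proof -
  interpret A: group_action G "carrier G" "\<lambda>g. \<lambda>h\<in>carrier G. g \<otimes> h \<otimes> inv g"
    by (rule action_by_conjugation)
  \<comment> \<open>Conjugation by \<open>g\<close> fixes exactly the elements commuting with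
    \<open>g\<close>, so the fixed-point counts are orders of centralizers.\<close>
  have "invariants (carrier G) (\<lambda>g. \<lambda>h\<in>carrier G. g \<otimes> h \<otimes> inv g) g =
      {h \<in> carrier G. g \<otimes> h = h \<otimes> g}" if "g \<in> carrier G" for g
    using that inv_solve_right'[of _ "g \<otimes> _" g] by (auto simp: invariants_def)
  then show ?thesis
    using A.burnside[OF assms assms] by (simp add: conjugacy_classes_def Coset.order_def)
qed

text \<open>An isomorphism carries centralizers onto centralizers, so the classes of a presented
  group can be counted in a model where commuting is explicit.\<close>

lemma card_conjugacy_classes_iso:
  assumes "group G" "group H" "\<phi> \<in> iso G H" "finite (carrier H)"
  shows "card (conjugacy_classes G) * card (carrier H) =
    (\<Sum>g\<in>carrier H. card {h \<in> carrier H. g \<otimes>\<^bsub>H\<^esub> h = h \<otimes>\<^bsub>H\<^esub> g})"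
proof -
  interpret G: group G by fact
  interpret H: group H by fact
  interpret group_hom G H \<phi>
    using assms(3) by unfold_locales (simp add: iso_def)
  have bij: "bij_betw \<phi> (carrier G) (carrier H)"
    using assms(3) by (simp add: iso_def)
  have "finite (carrier G)" "card (carrier G) = card (carrier H)"
    using bij assms(4) by (auto simp: bij_betw_finite bij_betw_same_card)
  moreover have "card {h \<in> carrier G. g \<otimes>\<^bsub>G\<^esub> h = h \<otimes>\<^bsub>G\<^esub> g} =
      card {h \<in> carrier H. \<phi> g \<otimes>\<^bsub>H\<^esub> h = h \<otimes>\<^bsub>H\<^esub> \<phi> g}" if g: "g \<in> carrier G" for g
  proof (rule bij_betw_same_card[of \<phi>], rule bij_betw_subset[OF bij])
    have "\<phi> g \<otimes>\<^bsub>H\<^esub> \<phi> h = \<phi> h \<otimes>\<^bsub>H\<^esub> \<phi> g \<longleftrightarrow> g \<otimes>\<^bsub>G\<^esub> h = h \<otimes>\<^bsub>G\<^esub> g"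
      if "h \<in> carrier G" for h
      using inj_onD[OF bij_betw_imp_inj_on[OF bij]] g that by (metis G.m_closed hom_mult)
    then show "\<phi> ` {h \<in> carrier G. g \<otimes>\<^bsub>G\<^esub> h = h \<otimes>\<^bsub>G\<^esub> g} =
        {h \<in> carrier H. \<phi> g \<otimes>\<^bsub>H\<^esub> h = h \<otimes>\<^bsub>H\<^esub> \<phi> g}"
      unfolding bij_betw_imp_surj_on[OF bij, symmetric] by blast
  qed auto
  ultimately show ?thesis
    using G.card_conjugacy_classes sum.reindex_bij_betw[OF bij, of "\<lambda>g. card {h \<in> carrier H. g \<otimes>\<^bsub>H\<^esub> h = h \<otimes>\<^bsub>H\<^esub> g}"]
    by simp
qed

section \<open>Counting commuting pairs\<close>

locale graphical_field = graphical R V E v + F: field R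
  for R :: "('a, 'm) ring_scheme" (structure) and V :: "'v set" and E v +
  assumes finite_R: "finite (carrier R)"
begin

abbreviation "q \<equiv> card (carrier R)"

lemma q_gt_1: "1 < q"
proof -
  have "card {\<zero>, \<one>} \<le> q"
    by (intro card_mono finite_R) auto
  then show ?thesis by simp
qed

text \<open>The first components of the elements that commute with an element of first component
  \<open>x\<close>. Imposing the condition on all ordered adjacent pairs makes it independent of the
  numbering of the vertices.\<close>

definition sol :: "('v \<Rightarrow> 'a) \<Rightarrow> ('v \<Rightarrow> 'a) set"
  where "sol x = {y \<in> V \<rightarrow>\<^sub>E carrier R. \<forall>a b. adjacent E a b \<longrightarrow> x a \<otimes> y b = x b \<otimes> y a}"

lemma sol_subset: "sol x \<subseteq> V \<rightarrow>\<^sub>E carrier R"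
  by (auto simp: sol_def)

lemma adjacent_mem: "adjacent E a b \<Longrightarrow> a \<in> V \<and> b \<in> V \<and> a \<noteq> b"
  using graph by (auto simp: simple_graph_def adjacent_def)

lemma adjacent_index:
  assumes "adjacent E a b"
  obtains j k where "(j, k) \<in> J" "a = v j" "b = v k" | j k where "(j, k) \<in> J" "a = v k" "b = v j"
proof -
  obtain i i' where i: "i \<in> {1..card V}" "a = v i" "i' \<in> {1..card V}" "b = v i'"
    using adjacent_mem[OF assms] bij_betw_imp_surj_on[OF enum] by blast
  then have "i < i' \<or> i' < i" using adjacent_mem[OF assms] by auto
  moreover have "adjacent E (v i) (v i')" "adjacent E (v i') (v i)"
    using assms i adjacent_commute[of a b] by simp_all
  ultimately have "(i, i') \<in> J \<or> (i', i) \<in> J"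
    using i by (simp add: edge_indices_iff)
  then show ?thesis using that i by blast
qed

text \<open>First components add commutatively and the central coordinates enter both products
  through the same sum, so they drop out; what remains is the equality of the two cocycle terms at
  every edge.\<close>

lemma model_commute_iff:
  assumes "g \<in> carrier model" "h \<in> carrier model"
  shows "g \<otimes>\<^bsub>model\<^esub> h = h \<otimes>\<^bsub>model\<^esub> g \<longleftrightarrow> fst h \<in> sol (fst g)"
proof -
  let ?x = "fst g" and ?y = "fst h"
  have eq: "s \<oplus> t \<ominus> c = t \<oplus> s \<ominus> d \<longleftrightarrow> c = d"
    if "s \<in> carrier R" "t \<in> carrier R" "c \<in> carrier R" "d \<in> carrier R" for s t c d
  proof -
    have "s \<oplus> t \<ominus> c = \<ominus> c \<oplus> (s \<oplus> t)" "t \<oplus> s \<ominus> d = \<ominus> d \<oplus> (s \<oplus> t)"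
      using that by algebra+
    moreover have "\<ominus> c \<oplus> (s \<oplus> t) = \<ominus> d \<oplus> (s \<oplus> t) \<longleftrightarrow> \<ominus> c = \<ominus> d"
      using that by simp
    moreover have "\<ominus> c = \<ominus> d \<longleftrightarrow> c = d"
      using that R.minus_minus by metis
    ultimately show ?thesis by simp
  qed
  have "g \<otimes>\<^bsub>model\<^esub> h = h \<otimes>\<^bsub>model\<^esub> g \<longleftrightarrow>
      (\<forall>p\<in>J. ?x (v (snd p)) \<otimes> ?y (v (fst p)) = ?y (v (snd p)) \<otimes> ?x (v (fst p)))"
    (is "?L \<longleftrightarrow> ?M")
  proof
    assume L: ?L
    show ?M
    proof
      fix p assume p: "p \<in> J"
      have "snd (g \<otimes>\<^bsub>model\<^esub> h) p = snd (h \<otimes>\<^bsub>model\<^esub> g) p" using L by simp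
      then show "?x (v (snd p)) \<otimes> ?y (v (fst p)) = ?y (v (snd p)) \<otimes> ?x (v (fst p))"
        using p assms by (simp add: model_mult_snd eq)
    qed
  next
    assume ?M
    then show ?L
      using assms by (intro model_eqI) (auto simp: model_mult_fst model_mult_snd R.a_comm)
  qed
  also have "\<dots> \<longleftrightarrow> ?y \<in> sol ?x"
  proof
    assume M: ?M
    have "?x a \<otimes> ?y b = ?x b \<otimes> ?y a" if "adjacent E a b" for a b
      using that
    proof (rule adjacent_index)
      fix j k assume "(j, k) \<in> J" "a = v j" "b = v k"
      then show ?thesis using M[rule_format, of "(j, k)"] assms by (simp add: R.m_comm)
    next
      fix j k assume "(j, k) \<in> J" "a = v k" "b = v j"
      then show ?thesis using M[rule_format, of "(j, k)"] assms by (simp add: R.m_comm)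
    qed
    then show "?y \<in> sol ?x" using assms(2) by (auto simp: sol_def model_carrier)
  next
    assume S: "?y \<in> sol ?x"
    show ?M
    proof
      fix p assume p: "p \<in> J"
      then have "adjacent E (v (snd p)) (v (fst p))"
        using adjacent_commute by (auto simp: edge_indices_def)
      then have "?x (v (snd p)) \<otimes> ?y (v (fst p)) = ?x (v (fst p)) \<otimes> ?y (v (snd p))"
        using S by (simp add: sol_def)
      then show "?x (v (snd p)) \<otimes> ?y (v (fst p)) = ?y (v (snd p)) \<otimes> ?x (v (fst p))"
        using p assms by (simp add: R.m_comm)
    qed
  qed
  finally show ?thesis .
qed

lemma card_J: "card J = card E"
proof (rule bij_betw_same_card)
  show "bij_betw (\<lambda>(j, k). {v j, v k}) J E"
    unfolding bij_betw_def
  proof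
    show "inj_on (\<lambda>(j, k). {v j, v k}) J"
      by (rule inj_onI) (auto simp: edge_indices_iff doubleton_eq_iff)
    show "(\<lambda>(j, k). {v j, v k}) ` J = E"
    proof
      show "(\<lambda>(j, k). {v j, v k}) ` J \<subseteq> E"
        by (auto simp: edge_indices_iff adjacent_def)
      show "E \<subseteq> (\<lambda>(j, k). {v j, v k}) ` J"
      proof
        fix e assume e: "e \<in> E"
        then have "card e = 2" using graph by (auto simp: simple_graph_def)
        then obtain a b where ab: "e = {a, b}" by (auto simp: card_2_iff)
        then have "adjacent E a b" using e by (simp add: adjacent_def)
        then show "e \<in> (\<lambda>(j, k). {v j, v k}) ` J"
          by (rule adjacent_index) (force simp: ab)+
      qed
    qed
  qed
qed

lemma finite_model: "finite (carrier model)"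
  by (auto simp: model_carrier finite_V finite_J finite_R intro!: finite_PiE)

text \<open>A centralizer in the model is \<open>sol x\<close> times the full space of central
  coordinates, and each \<open>x\<close> occurs with every choice of \<open>s\<close>; this accounts
  for the two factors \<open>q ^ card E\<close> on the right. The group order stays on the left to
  avoid dividing natural numbers.\<close>

lemma card_conjugacy_classes_GG:
  "card (conjugacy_classes GG) * (q ^ card V * q ^ card E) =
    q ^ card E * q ^ card E * (\<Sum>x\<in>V \<rightarrow>\<^sub>E carrier R. card (sol x))"
proof -
  obtain \<phi> where "\<phi> \<in> iso GG model" using graphical_group_iso by blast
  note * = card_conjugacy_classes_iso[OF group_GG group_model this finite_model]
  have J: "card (J \<rightarrow>\<^sub>E carrier R) = q ^ card E"
    by (simp add: card_funcsetE finite_J card_J)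
  have "card (carrier model) = q ^ card V * q ^ card E"
    by (simp add: model_carrier card_cartesian_product card_funcsetE finite_V J)
  moreover have "card {h \<in> carrier model. g \<otimes>\<^bsub>model\<^esub> h = h \<otimes>\<^bsub>model\<^esub> g} = q ^ card E * card (sol (fst g))"
    if "g \<in> carrier model" for g
  proof -
    have "{h \<in> carrier model. g \<otimes>\<^bsub>model\<^esub> h = h \<otimes>\<^bsub>model\<^esub> g} = {h \<in> carrier model. fst h \<in> sol (fst g)}"
      using model_commute_iff[OF that] by blast
    also have "\<dots> = sol (fst g) \<times> (J \<rightarrow>\<^sub>E carrier R)"
      using sol_subset by (auto simp: model_carrier)
    finally show ?thesis by (simp add: card_cartesian_product J)
  qed
  moreover have "(\<Sum>g\<in>carrier model. q ^ card E * card (sol (fst g))) =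
      q ^ card E * q ^ card E * (\<Sum>x\<in>V \<rightarrow>\<^sub>E carrier R. card (sol x))"
    unfolding model_carrier
    by (simp add: sum.cartesian_product' J sum_distrib_left mult_ac)
  ultimately show ?thesis using * by simp
qed

section \<open>Vectors sorted by support\<close>

definition supp :: "('v \<Rightarrow> 'a) \<Rightarrow> 'v set"
  where "supp x = {a \<in> V. x a \<noteq> \<zero>}"

lemma card_supp_fibre:
  assumes "U \<subseteq> V"
  shows "card {x \<in> V \<rightarrow>\<^sub>E carrier R. supp x = U} = (q - 1) ^ card U"
proof -
  have "{x \<in> V \<rightarrow>\<^sub>E carrier R. supp x = U} =
      (\<Pi>\<^sub>E a\<in>V. if a \<in> U then carrier R - {\<zero>} else {\<zero>})" (is "?A = ?B")
  proof
    show "?A \<subseteq> ?B" by (auto simp: supp_def PiE_iff extensional_def)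
    show "?B \<subseteq> ?A" using assms by (force simp: supp_def PiE_iff split: if_splits)
  qed
  then have "card {x \<in> V \<rightarrow>\<^sub>E carrier R. supp x = U} = (\<Prod>a\<in>V. if a \<in> U then q - 1 else 1)"
    by (simp add: card_PiE finite_V finite_R if_distrib cong: if_cong)
  also have "\<dots> = (q - 1) ^ card U"
    using prod.inter_restrict[OF finite_V, of "\<lambda>_. q - 1" U] assms
    by (simp add: inf_absorb2)
  finally show ?thesis .
qed

text \<open>Grouping by support is the origin of the sum over subsets and, through the choice of a
  nonzero entry at each vertex of \<open>U\<close>, of the factor that becomes
  \<open>(X - 1) ^ card U\<close>.\<close>

lemma sum_by_supp:
  "(\<Sum>x\<in>V \<rightarrow>\<^sub>E carrier R. f (supp x)) = (\<Sum>U\<in>Pow V. (q - 1) ^ card U * f U)"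
  for f :: "'v set \<Rightarrow> nat"
proof -
  have "(\<Sum>x\<in>V \<rightarrow>\<^sub>E carrier R. f (supp x)) =
      (\<Sum>U\<in>Pow V. \<Sum>x\<in>{x \<in> V \<rightarrow>\<^sub>E carrier R. supp x = U}. f (supp x))"
    by (intro sum.group[symmetric] finite_PiE)
      (auto simp: finite_V finite_R supp_def)
  also have "\<dots> = (\<Sum>U\<in>Pow V. (q - 1) ^ card U * f U)"
  proof (rule sum.cong[OF HOL.refl])
    fix U assume "U \<in> Pow V"
    then show "(\<Sum>x\<in>{x \<in> V \<rightarrow>\<^sub>E carrier R. supp x = U}. f (supp x)) = (q - 1) ^ card U * f U"
      using card_supp_fibre[of U] sum.cong[of _ _ "\<lambda>x. f (supp x)" "\<lambda>_. f U"] by simp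
  qed
  finally show ?thesis .
qed

section \<open>Components of induced subgraphs\<close>

abbreviation "comp_rel U \<equiv> {(u, w). adjacent (induced_edges E U) u w}\<^sup>*"

lemma adjacent_induced_iff: "adjacent (induced_edges E U) u w \<longleftrightarrow> adjacent E u w \<and> u \<in> U \<and> w \<in> U"
  by (auto simp: adjacent_def induced_edges_def)

lemma comp_rel_sym: "(u, w) \<in> comp_rel U \<Longrightarrow> (w, u) \<in> comp_rel U"
proof -
  have "sym {(u, w). adjacent (induced_edges E U) u w}"
    using adjacent_commute by (auto simp: sym_def adjacent_induced_iff)
  then show "(u, w) \<in> comp_rel U \<Longrightarrow> (w, u) \<in> comp_rel U"
    using sym_rtrancl by (metis symD)
qed

lemma comp_rel_mem: "(u, w) \<in> comp_rel U \<Longrightarrow> u \<in> U \<Longrightarrow> w \<in> U"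
  by (induction rule: rtrancl_induct) (auto simp: adjacent_induced_iff)

text \<open>One vertex is chosen from each component, so that components can be counted as a set of
  vertices, namely the image of \<open>U\<close> under \<rho>.\<close>

lemma component_representatives:
  obtains \<rho> where "\<And>u. u \<in> U \<Longrightarrow> (\<rho> u, u) \<in> comp_rel U"
    and "\<And>u w. adjacent E u w \<Longrightarrow> u \<in> U \<Longrightarrow> w \<in> U \<Longrightarrow> \<rho> u = \<rho> w"
    and "\<And>u. u \<in> U \<Longrightarrow> \<rho> u \<in> U" "\<And>u. u \<in> U \<Longrightarrow> \<rho> (\<rho> u) = \<rho> u"
    and "card (\<rho> ` U) = num_components E U"
proof -
  \<comment> \<open>The choice depends on the class alone, which makes \<rho> constant on
    components.\<close>
  define r where "r c = (SOME u. u \<in> c)" for c :: "'v set"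
  define \<rho> where "\<rho> u = r (comp_rel U `` {u})" for u
  have 1: "(u, \<rho> u) \<in> comp_rel U" for u
  proof -
    have "u \<in> comp_rel U `` {u}" by simp
    then have "\<rho> u \<in> comp_rel U `` {u}" unfolding \<rho>_def r_def by (rule someI)
    then show ?thesis by simp
  qed
  have class_eq: "comp_rel U `` {u} = comp_rel U `` {w}" if "(u, w) \<in> comp_rel U" for u w
    using that comp_rel_sym[OF that] by (auto intro: rtrancl_trans)
  have 2: "\<rho> u = \<rho> w" if "(u, w) \<in> comp_rel U" for u w
    using class_eq[OF that] by (simp add: \<rho>_def)
  have "bij_betw r (connected_components U (induced_edges E U)) (\<rho> ` U)"
    unfolding bij_betw_def
  proof
    show "inj_on r (connected_components U (induced_edges E U))"
    proof (rule inj_onI)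
      fix c d assume "c \<in> connected_components U (induced_edges E U)"
        "d \<in> connected_components U (induced_edges E U)" and eq: "r c = r d"
      then obtain u w where "c = comp_rel U `` {u}" "d = comp_rel U `` {w}"
        by (auto simp: connected_components_def quotient_def)
      then show "c = d"
        using eq class_eq[OF 1, of u] class_eq[OF 1, of w] unfolding \<rho>_def by metis
    qed
    show "r ` connected_components U (induced_edges E U) = \<rho> ` U"
      by (auto simp: connected_components_def quotient_def \<rho>_def)
  qed
  then have "card (\<rho> ` U) = num_components E U"
    unfolding num_components_def by (rule bij_betw_same_card[symmetric])
  moreover have "\<rho> u = \<rho> w" if "adjacent E u w" "u \<in> U" "w \<in> U" for u w
    using that by (intro 2 r_into_rtrancl) (simp add: adjacent_induced_iff)
  ultimately show ?thesis
    using that[of \<rho>] comp_rel_sym[OF 1] comp_rel_mem[OF 1] 2[OF 1] by simp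
qed

section \<open>Size of the solution spaces\<close>

lemma solD: "y \<in> sol x \<Longrightarrow> adjacent E a b \<Longrightarrow> x a \<otimes> y b = x b \<otimes> y a"
  unfolding sol_def by blast

text \<open>The ratio y/x is constant along a path inside the support. The claim is cross-multiplied
  to avoid division; in the induction step the nonzero entry \<open>x w\<close> at the intermediate
  vertex is cancelled.\<close>

lemma sol_comp_rel:
  assumes "x \<in> V \<rightarrow>\<^sub>E carrier R" "y \<in> sol x" "(u, w) \<in> comp_rel (supp x)" "u \<in> supp x"
  shows "x u \<otimes> y w = x w \<otimes> y u"
  using assms(3)
proof (induction rule: rtrancl_induct)
  case (step w z)
  have y: "y \<in> V \<rightarrow>\<^sub>E carrier R" using assms(2) sol_subset by blast
  have "w \<in> supp x" "z \<in> supp x" and adj: "adjacent E w z"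
    using step by (auto simp: adjacent_induced_iff)
  then have V: "u \<in> V" "w \<in> V" "z \<in> V" "x w \<noteq> \<zero>" using assms(4) by (auto simp: supp_def)
  then have mem: "x u \<in> carrier R" "x w \<in> carrier R" "x z \<in> carrier R"
    "y u \<in> carrier R" "y w \<in> carrier R" "y z \<in> carrier R"
    using assms(1) y by auto
  have "x w \<otimes> y z = x z \<otimes> y w"
    by (rule solD[OF assms(2) adj])
  then have "x w \<otimes> (x u \<otimes> y z) = x z \<otimes> (x u \<otimes> y w)"
    using mem R.m_lcomm by metis
  also have "\<dots> = x w \<otimes> (x z \<otimes> y u)"
    unfolding step.IH using mem R.m_lcomm by metis
  finally show ?case
    using F.m_lcancel[OF V(4)] mem by simp
qed (use assms in simp)

lemma supp_subset_nbhd: "U \<subseteq> V \<Longrightarrow> U \<subseteq> closed_nbhd V E U"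
  by (auto simp: closed_nbhd_def)

lemma closed_nbhd_subset: "closed_nbhd V E U \<subseteq> V"
  by (auto simp: closed_nbhd_def)

lemma card_sol:
  assumes x: "x \<in> V \<rightarrow>\<^sub>E carrier R"
  shows "card (sol x) = q ^ (num_components E (supp x) + (card V - card (closed_nbhd V E (supp x))))"
proof -
  define U where "U = supp x"
  define N where "N = closed_nbhd V E U"
  have UV: "U \<subseteq> V" by (auto simp: U_def supp_def)
  have UN: "U \<subseteq> N" and NV: "N \<subseteq> V"
    using supp_subset_nbhd[OF UV] closed_nbhd_subset by (auto simp: N_def)
  have N_iff: "a \<in> N" if "adjacent E u a" "u \<in> U" for u a
    using that adjacent_mem by (auto simp: N_def closed_nbhd_def)
  have xU: "x a \<in> carrier R" "x a \<noteq> \<zero>" "x a \<in> Units R" if "a \<in> U" for a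
    using that x F.field_Units by (auto simp: U_def supp_def)
  have x0: "x a = \<zero>" if "a \<in> V" "a \<notin> U" for a
    using that by (auto simp: U_def supp_def)
  obtain \<rho> where \<rho>: "\<And>u. u \<in> U \<Longrightarrow> (\<rho> u, u) \<in> comp_rel U"
    "\<And>u w. adjacent E u w \<Longrightarrow> u \<in> U \<Longrightarrow> w \<in> U \<Longrightarrow> \<rho> u = \<rho> w"
    "\<And>u. u \<in> U \<Longrightarrow> \<rho> u \<in> U" "\<And>u. u \<in> U \<Longrightarrow> \<rho> (\<rho> u) = \<rho> u"
    and card_\<rho>: "card (\<rho> ` U) = num_components E U"
    using component_representatives[of U] by blast
  \<comment> \<open>The free parameters sit at one representative of each component, which carries
    the common ratio y/x of that component, and at every vertex outside \<open>N\<close>, which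
    carries the value of y itself.\<close>
  define D where "D = \<rho> ` U \<union> (V - N)"
  define extend where "extend f = (\<lambda>a\<in>V. if a \<in> U then x a \<otimes> f (\<rho> a) else if a \<in> N then \<zero> else f a)"
    for f
  define ratio where "ratio y = (\<lambda>a\<in>D. if a \<in> U then y a \<otimes> inv (x a) else y a)" for y
  \<comment> \<open>By idempotence of \<rho>, a vertex of \<open>U\<close> that lies in
    \<open>D\<close> represents itself; this makes \<open>ratio\<close> undo
    \<open>extend\<close>.\<close>
  have D_U: "D \<subseteq> V" "\<And>a. a \<in> D \<Longrightarrow> a \<in> U \<Longrightarrow> \<rho> a = a"
    using \<rho>(3,4) UV UN by (auto simp: D_def)
  have \<rho>D: "\<rho> a \<in> D" if "a \<in> U" for a using that by (simp add: D_def)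
  have "bij_betw extend (D \<rightarrow>\<^sub>E carrier R) (sol x)"
  proof (rule bij_betw_byWitness[where f' = ratio])
    show "\<forall>f\<in>D \<rightarrow>\<^sub>E carrier R. ratio (extend f) = f"
    proof
      fix f assume f: "f \<in> D \<rightarrow>\<^sub>E carrier R"
      show "ratio (extend f) = f"
      proof (rule extensionalityI[of _ D])
        fix a assume a: "a \<in> D"
        have fa: "f a \<in> carrier R" using f a by auto
        show "ratio (extend f) a = f a"
        proof (cases "a \<in> U")
          case True
          then have "x a \<otimes> f a \<otimes> inv (x a) = f a"
            using xU[OF True] fa by (metis R.Units_inv_closed R.Units_r_inv R.m_assoc R.m_comm R.r_one)
          then show ?thesis
            using a True D_U UV by (auto simp: ratio_def extend_def)
        next
          case False
          then show ?thesis using a D_U(1) \<rho>(3) by (auto simp: ratio_def extend_def D_def)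
        qed
      qed (use f in \<open>auto simp: ratio_def PiE_def\<close>)
    qed
    show "\<forall>y\<in>sol x. extend (ratio y) = y"
    proof
      fix y assume y: "y \<in> sol x"
      then have yV: "y \<in> V \<rightarrow>\<^sub>E carrier R" using sol_subset by blast
      show "extend (ratio y) = y"
      proof (rule extensionalityI[of _ V])
        fix a assume a: "a \<in> V"
        then have ya: "y a \<in> carrier R" using yV by auto
        consider "a \<in> U" | "a \<in> N" "a \<notin> U" | "a \<notin> N" "a \<notin> U" using UN by blast
        then show "extend (ratio y) a = y a"
        proof cases
          case 1
          let ?b = "\<rho> a"
          have b: "?b \<in> U" "?b \<in> V" using 1 \<rho>(3) UV by auto
          have "y ?b \<in> carrier R" using b yV by auto
          note mem = xU[OF 1] xU[OF b(1)] ya this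
          have "x ?b \<otimes> y a = x a \<otimes> y ?b"
            using sol_comp_rel[OF x y, of ?b a] \<rho>(1)[OF 1] b(1) by (simp add: U_def)
          then have "x a \<otimes> (y ?b \<otimes> inv (x ?b)) = x ?b \<otimes> y a \<otimes> inv (x ?b)"
            using mem by (simp add: R.m_assoc)
          also have "\<dots> = y a"
            using mem by (metis R.Units_inv_closed R.Units_r_inv R.m_assoc R.m_comm R.r_one)
          finally show ?thesis
            using 1 a b \<rho>D by (simp add: extend_def ratio_def)
        next
          case 2
          \<comment> \<open>In the equation of an edge from \<open>U\<close> to \<open>a\<close> the
            entry \<open>x a\<close> is zero and \<open>x u\<close> is not, which forces
            \<open>y a\<close> to vanish.\<close>
          then obtain u where u: "u \<in> U" "adjacent E u a"
            by (auto simp: N_def closed_nbhd_def)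
          have "x u \<otimes> y a = x a \<otimes> y u" by (rule solD[OF y u(2)])
          moreover have "y u \<in> carrier R" using u UV yV by auto
          ultimately have "x u \<otimes> y a = \<zero>" using x0[OF a 2(2)] by simp
          then have "y a = \<zero>" using xU[OF u(1)] ya F.integral by blast
          then show ?thesis using 2 a by (simp add: extend_def)
        next
          case 3
          then show ?thesis using a by (auto simp: extend_def ratio_def D_def)
        qed
      qed (use yV in \<open>auto simp: extend_def PiE_def\<close>)
    qed
    show "extend ` (D \<rightarrow>\<^sub>E carrier R) \<subseteq> sol x"
    proof
      fix y assume "y \<in> extend ` (D \<rightarrow>\<^sub>E carrier R)"
      then obtain f where f: "f \<in> D \<rightarrow>\<^sub>E carrier R" and y: "y = extend f" by blast
      have fD: "f a \<in> carrier R" if "a \<in> D" for a using that f by auto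
      have yV: "y a \<in> carrier R" if "a \<in> V" for a
        using that fD xU \<rho>D by (auto simp: y extend_def D_def)
      have y0: "y a = \<zero>" if "a \<in> N" "a \<notin> U" for a
        using that NV by (auto simp: y extend_def)
      \<comment> \<open>Adjacent vertices of \<open>U\<close> share their representative; for an
        edge leaving \<open>U\<close> both vectors vanish at the outer end, which lies in
        \<open>N\<close>; for an edge avoiding \<open>U\<close> both entries of \<open>x\<close>
        vanish.\<close>
      have "x a \<otimes> y b = x b \<otimes> y a" if ab: "adjacent E a b" for a b
      proof -
        have V: "a \<in> V" "b \<in> V" using adjacent_mem[OF ab] by auto
        consider "a \<in> U" "b \<in> U" | "a \<in> U" "b \<notin> U" | "a \<notin> U" "b \<in> U" | "a \<notin> U" "b \<notin> U" by blast
        then show ?thesis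
        proof cases
          case 1
          then show ?thesis
            using \<rho>(2)[OF ab 1] fD \<rho>D xU V by (simp add: y extend_def R.m_lcomm)
        next
          case 2
          then show ?thesis
            using N_iff[OF ab] x0[OF V(2)] xU(1) V yV[OF V(1)] y0[of b] by simp
        next
          case 3
          then show ?thesis
            using N_iff[of b a] ab adjacent_commute[of a b] x0[OF V(1)] xU(1) V yV[OF V(2)] y0[of a]
            by simp
        next
          case 4
          then show ?thesis using x0 V yV by simp
        qed
      qed
      moreover have "y \<in> V \<rightarrow>\<^sub>E carrier R"
        using yV by (intro PiE_I) (auto simp: y extend_def)
      ultimately show "y \<in> sol x" unfolding sol_def by blast
    qed
    show "ratio ` sol x \<subseteq> D \<rightarrow>\<^sub>E carrier R"
    proof
      fix f assume "f \<in> ratio ` sol x"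
      then obtain y where y: "y \<in> V \<rightarrow>\<^sub>E carrier R" and f: "f = ratio y" using sol_subset by blast
      have "y a \<in> carrier R" if "a \<in> D" for a using PiE_mem[OF y] that D_U(1) by blast
      then show "f \<in> D \<rightarrow>\<^sub>E carrier R"
        using xU(3) by (intro PiE_I) (auto simp: f ratio_def)
    qed
  qed
  then have "card (sol x) = card (D \<rightarrow>\<^sub>E carrier R)"
    by (simp add: bij_betw_same_card)
  also have "\<dots> = q ^ card D"
    using finite_subset[OF D_U(1) finite_V] by (simp add: card_funcsetE)
  also have "card D = card (\<rho> ` U) + card (V - N)"
    unfolding D_def using \<rho>(3) UN UV finite_V
    by (intro card_Un_disjoint) (auto intro: finite_subset)
  also have "card (V - N) = card V - card N"
    using NV finite_V by (intro card_Diff_subset) (auto intro: finite_subset)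
  finally show ?thesis
    using card_\<rho> by (simp add: U_def N_def)
qed

text \<open>The sets \<open>sol x\<close> are kernels of linear maps into a space of dimension \<open>card E\<close>,
  so their codimension is at most \<open>card E\<close>.\<close>

lemma card_closed_nbhd_le:
  assumes "U \<subseteq> V"
  shows "card (closed_nbhd V E U) \<le> card E + num_components E U"
proof -
  \<comment> \<open>The indicator vector has support \<open>U\<close>, so \<open>card_sol\<close>
    applied to it speaks about \<open>U\<close>.\<close>
  define x where "x = (\<lambda>a\<in>V. if a \<in> U then \<one> else \<zero>)"
  have x: "x \<in> V \<rightarrow>\<^sub>E carrier R" by (auto simp: x_def)
  have supp: "supp x = U" using assms by (auto simp: supp_def x_def)
  \<comment> \<open>The edge equations as a linear map with kernel \<open>sol x\<close>.\<close>
  define d where "d y = (\<lambda>p\<in>J. x (v (fst p)) \<otimes> y (v (snd p)) \<ominus> x (v (snd p)) \<otimes> y (v (fst p)))" for y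
  let ?A = "V \<rightarrow>\<^sub>E carrier R" and ?B = "J \<rightarrow>\<^sub>E carrier R"
  have xV: "x a \<in> carrier R" if "a \<in> V" for a using that x by auto
  have fin: "finite ?A" "finite ?B"
    by (auto intro!: finite_PiE simp: finite_V finite_J finite_R)
  have fin_sol: "finite (sol x)" by (rule finite_subset[OF sol_subset fin(1)])
  \<comment> \<open>A nonempty fibre is a translate of the kernel: subtracting a fixed member
    \<open>z\<close> maps it injectively into \<open>sol x\<close>.\<close>
  have fibre: "card {y \<in> ?A. d y = b} \<le> card (sol x)" for b
  proof (cases "\<exists>z\<in>?A. d z = b")
    case False
    then have "{y \<in> ?A. d y = b} = {}" by blast
    then show ?thesis by (simp only: card.empty le0)
  next
    case True
    then obtain z where z: "z \<in> ?A" "d z = b" by blast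
    let ?f = "\<lambda>y. \<lambda>a\<in>V. y a \<ominus> z a"
    have "inj_on ?f {y \<in> ?A. d y = b}"
    proof (rule inj_onI)
      fix y w assume y: "y \<in> {y \<in> ?A. d y = b}" and w: "w \<in> {y \<in> ?A. d y = b}" and eq: "?f y = ?f w"
      show "y = w"
      proof (rule PiE_ext[of _ V "\<lambda>_. carrier R"])
        fix a assume a: "a \<in> V"
        then have mem: "y a \<in> carrier R" "w a \<in> carrier R" "z a \<in> carrier R" using y w z by auto
        have "y a \<ominus> z a = w a \<ominus> z a" using fun_cong[OF eq, of a] a by simp
        then show "y a = w a" using mem by (simp add: R.minus_eq)
      qed (use y w in auto)
    qed
    moreover have "?f ` {y \<in> ?A. d y = b} \<subseteq> sol x"
    proof
      fix w assume "w \<in> ?f ` {y \<in> ?A. d y = b}"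
      then obtain y where y: "y \<in> ?A" "d y = b" and w: "w = ?f y" by blast
      have J: "x (v j) \<otimes> w (v k) = x (v k) \<otimes> w (v j)" if p: "(j, k) \<in> J" for j k
      proof -
        have mem: "y (v j) \<in> carrier R" "y (v k) \<in> carrier R" "z (v j) \<in> carrier R" "z (v k) \<in> carrier R"
          "x (v j) \<in> carrier R" "x (v k) \<in> carrier R"
          using edge_indices_pair_mem[OF p] PiE_mem[OF y(1)] PiE_mem[OF z(1)] xV by blast+
        have "d y (j, k) = d z (j, k)" using y z by simp
        then have eq: "x (v j) \<otimes> y (v k) \<ominus> x (v k) \<otimes> y (v j) = x (v j) \<otimes> z (v k) \<ominus> x (v k) \<otimes> z (v j)"
          using p by (simp add: d_def)
        have "x (v j) \<otimes> (y (v k) \<ominus> z (v k)) =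
            (x (v j) \<otimes> y (v k) \<ominus> x (v k) \<otimes> y (v j)) \<oplus> x (v k) \<otimes> y (v j) \<ominus> x (v j) \<otimes> z (v k)"
          using mem by algebra
        also have "\<dots> = x (v k) \<otimes> (y (v j) \<ominus> z (v j))"
          unfolding eq using mem by algebra
        finally show ?thesis using p by (simp add: w)
      qed
      have "x a \<otimes> w b = x b \<otimes> w a" if "adjacent E a b" for a b
        using that by (rule adjacent_index) (metis J)+
      moreover have "w \<in> V \<rightarrow>\<^sub>E carrier R"
        using PiE_mem[OF y(1)] PiE_mem[OF z(1)] by (simp add: w)
      ultimately show "w \<in> sol x" unfolding sol_def by blast
    qed
    ultimately show ?thesis using fin_sol by (rule card_inj_on_le)
  qed
  \<comment> \<open>Counting replaces rank and nullity: there are \<open>q ^ card E\<close> possible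
    values, each with a fibre no larger than the kernel, and exponents of \<open>q\<close> can be
    compared because \<open>q > 1\<close>.\<close>
  have "q ^ card V = card ?A" by (simp add: card_funcsetE finite_V)
  also have "\<dots> = (\<Sum>b\<in>?B. card {y \<in> ?A. d y = b})"
  proof -
    have "d ` ?A \<subseteq> ?B"
    proof
      fix b assume "b \<in> d ` ?A"
      then obtain y where y: "y \<in> ?A" and b: "b = d y" by blast
      have "y (v (fst p)) \<in> carrier R" "y (v (snd p)) \<in> carrier R" if "p \<in> J" for p
        using PiE_mem[OF y] edge_indices_mem[OF that] by blast+
      then show "b \<in> ?B"
        using xV by (simp add: b d_def)
    qed
    from sum.group[OF fin this, of "\<lambda>_. 1::nat"] show ?thesis by simp
  qed
  also have "\<dots> \<le> card ?B * card (sol x)"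
    using sum_bounded_above[of ?B "\<lambda>b. card {y \<in> ?A. d y = b}"] fibre by simp
  also have "\<dots> = q ^ (card E + (num_components E U + (card V - card (closed_nbhd V E U))))"
    by (simp add: card_sol[OF x] supp card_funcsetE finite_J card_J power_add)
  finally have "card V \<le> card E + (num_components E U + (card V - card (closed_nbhd V E U)))"
    using q_gt_1 power_increasing_iff by blast
  moreover have "card (closed_nbhd V E U) \<le> card V"
    by (intro card_mono finite_V closed_nbhd_subset)
  ultimately show ?thesis by linarith
qed

text \<open>Write n for the number of vertices and m for the number of edges. Dividing Burnside's
  identity by the group order q^(n + m) turns the exponent 2m + c(U) + n - |N[U]| into m + c(U) -
  |N[U]|.\<close>

theorem class_count:
  "card (conjugacy_classes GG) = (\<Sum>U\<in>Pow V. (q - 1) ^ card U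
    * q ^ (card E + num_components E U - card (closed_nbhd V E U)))"
proof -
  let ?n = "card V" and ?m = "card E"
  let ?c = "num_components E" and ?N = "\<lambda>U. card (closed_nbhd V E U)"
  have "card (conjugacy_classes GG) * (q ^ ?n * q ^ ?m) =
      q ^ ?m * q ^ ?m * (\<Sum>x\<in>V \<rightarrow>\<^sub>E carrier R. q ^ (?c (supp x) + (?n - ?N (supp x))))"
    unfolding card_conjugacy_classes_GG by (simp add: card_sol)
  also have "\<dots> = (\<Sum>U\<in>Pow V. (q - 1) ^ card U * (q ^ ?m * q ^ ?m * q ^ (?c U + (?n - ?N U))))"
    by (simp add: sum_by_supp[of "\<lambda>U. q ^ (?c U + (?n - ?N U))"] sum_distrib_left mult_ac)
  also have "\<dots> = (\<Sum>U\<in>Pow V. (q - 1) ^ card U * (q ^ (?m + ?c U - ?N U) * (q ^ ?n * q ^ ?m)))"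
  proof (rule sum.cong[OF HOL.refl])
    fix U assume "U \<in> Pow V"
    \<comment> \<open>This bound and the next one make the truncated subtractions exact.\<close>
    then have "?N U \<le> ?m + ?c U" by (intro card_closed_nbhd_le) auto
    moreover have "?N U \<le> ?n"
      by (intro card_mono finite_V closed_nbhd_subset)
    ultimately have "?m + ?m + (?c U + (?n - ?N U)) = ?m + ?c U - ?N U + (?n + ?m)" by linarith
    then show "(q - 1) ^ card U * (q ^ ?m * q ^ ?m * q ^ (?c U + (?n - ?N U))) =
        (q - 1) ^ card U * (q ^ (?m + ?c U - ?N U) * (q ^ ?n * q ^ ?m))"
      by (simp only: power_add[symmetric])
  qed
  also have "\<dots> = (\<Sum>U\<in>Pow V. (q - 1) ^ card U * q ^ (?m + ?c U - ?N U)) * (q ^ ?n * q ^ ?m)"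
    by (simp only: sum_distrib_right mult.assoc)
  finally show ?thesis using q_gt_1 by simp
qed

end

section \<open>The class-counting polynomial\<close>

text \<open>A nonzero difference would have infinitely many roots, since there are infinitely many
  primes.\<close>

lemma poly_eqI_primes:
  fixes f g :: "rat poly"
  assumes "\<And>p::nat. prime p \<Longrightarrow> poly f (of_nat p) = poly g (of_nat p)"
  shows "f = g"
proof (rule ccontr)
  assume "f \<noteq> g"
  then have "finite {x. poly (f - g) x = 0}" by (intro poly_roots_finite) simp
  moreover have "of_nat ` {p::nat. prime p} \<subseteq> {x. poly (f - g) x = 0}"
    using assms by auto
  ultimately have "finite {p::nat. prime p}"
    by (metis finite_subset finite_imageD inj_on_of_nat)
  then show False using primes_infinite by simp
qed

text \<open>For every prime p the residue ring modulo p is a field whose carrier is a set of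
  integers, so the condition at \<open>q = p\<close> is not vacuous and fixes the value
  there.\<close>

lemma is_class_counting_poly_unique:
  assumes "is_class_counting_poly V E v f" "is_class_counting_poly V E v g"
  shows "f = g"
proof (rule poly_eqI_primes)
  fix p :: nat assume p: "prime p"
  interpret residues_prime p "residue_ring (int p)"
    by unfold_locales (rule p)
  have card: "card (carrier (residue_ring (int p))) = p" "finite (carrier (residue_ring (int p)))"
    by (simp_all add: residue_ring_def)
  have "primepow p" using p by simp
  then show "poly f (of_nat p) = poly g (of_nat p)"
    using assms is_field card unfolding is_class_counting_poly_def by metis
qed

section \<open>From integer to rational coefficients\<close>

lemma map_poly_of_int_simps:
  "map_poly rat_of_int (p + q) = map_poly of_int p + map_poly of_int q"
  "map_poly rat_of_int (p - q) = map_poly of_int p - map_poly of_int q"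
  "map_poly rat_of_int (p * q) = map_poly of_int p * map_poly of_int q"
  by (auto intro!: poly_eqI simp: coeff_map_poly coeff_mult)

lemma map_poly_of_int_power: "map_poly rat_of_int (p ^ n) = map_poly of_int p ^ n"
  by (induction n) (simp_all add: map_poly_of_int_simps)

lemma map_poly_of_int_sum: "map_poly rat_of_int (\<Sum>a\<in>A. f a) = (\<Sum>a\<in>A. map_poly of_int (f a))"
  by (induction A rule: infinite_finite_induct) (simp_all add: map_poly_of_int_simps)

lemma class_size_poly_at_1:
  "map_poly rat_of_int (poly (class_size_poly V E) 1) =
    (\<Sum>U\<in>Pow V. ([:0, 1:] - 1) ^ card U
      * [:0, 1:] ^ (card E + num_components E U - card (closed_nbhd V E U)))"
  by (simp add: class_size_poly_def Let_def poly_sum poly_mult poly_power map_poly_of_int_sum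
      map_poly_of_int_simps map_poly_of_int_power map_poly_pCons)

theorem corollary2:
  fixes V :: "'v set" and E :: "'v set set" and v :: "nat \<Rightarrow> 'v"
  assumes "simple_graph V E"
    and "bij_betw v {1..card V} V"
  shows "class_counting_poly V E v = map_poly rat_of_int (poly (class_size_poly V E) 1)
    \<and> map_poly rat_of_int (poly (class_size_poly V E) 1) =
      (\<Sum>U\<in>Pow V. ([:0, 1:] - 1) ^ card U
        * [:0, 1:] ^ (card E + num_components E U - card (closed_nbhd V E U)))"
proof -
  let ?F = "map_poly rat_of_int (poly (class_size_poly V E) 1)"
  have F: "is_class_counting_poly V E v ?F"
    unfolding is_class_counting_poly_def
  proof (intro allI impI, elim conjE)
    fix q :: nat and K :: "int ring"
    assume K: "field K" "finite (carrier K)" and q: "card (carrier K) = q"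
    interpret K: field K by fact
    interpret graphical_field K V E v
      by unfold_locales (use assms K in auto)
    \<comment> \<open>In \<open>class_count\<close> the term \<open>q - 1\<close> is a truncated
      difference of natural numbers; this bound identifies it with the value of X - 1 at
      \<open>q\<close>.\<close>
    have "1 \<le> q" using q_gt_1 q by simp
    then show "poly ?F (of_nat q) = of_nat (card (conjugacy_classes (graphical_group V E v K)))"
      by (simp add: class_count q class_size_poly_at_1 poly_sum poly_mult poly_power)
  qed
  \<comment> \<open>\<open>?F\<close> is itself the witness for existence, and uniqueness identifies
    it with the definite description.\<close>
  then have "class_counting_poly V E v = ?F"
    unfolding class_counting_poly_def
    by (rule the_equality) (rule is_class_counting_poly_unique[OF _ F])
  then show ?thesis
    using class_size_poly_at_1[of V E] by blast
qed

end
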